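(* Let $q$ be a prime power and $n\ge 0$. (1) Let $\{\lambda_\phi\}$ be the rational canonical form data of some element of $GL(n+1,q)$. Then the number of elements $\alpha\in A(n,q)$ whose rational canonical form data (as an element of $GL(n+1,q)$) equals $\{\lambda_\phi\}$ is \[ \frac{|A(n,q)|\,\bigl(q^{\lambda'_{z-1,1}}-1\bigr)}{\prod_{\phi\neq z}\Bigl( q^{\deg(\phi)\sum_i (\lambda'_{\phi,i})^2}\prod_i \bigl(\tfrac{1}{q^{\deg(\phi)}}\bigr)_{m_i(\lambda_\phi)}\Bigr)}. \] (2) With $\{\lambda_\phi\}$ as in (1), the number of elements of $P(n,q)$ whose rational canonical form data equals $\{\lambda_\phi\}$ is \[ \sum_{a\in \mathbb{F}_q^*}\frac{|P(n,q)|\,\bigl(q^{\lambda'_{z-a,1}}-1\bigr)}{q-1}\cdot\frac{1}{\prod_{\phi\neq z}\Bigl( q^{\deg(\phi)\sum_i (\lambda'_{\phi,i})^2}\prod_i \bigl(\tfrac{1}{q^{\deg(\phi)}}\bigr)_{m_i(\lambda_\phi)}\Bigr)}. \]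
   Context: $A(n,q)$ is the group of matrices $x\in GL(n+1,q)$ with $x_{11}=1$ and $x_{j1}=0$ for $j\ge 2$; $P(n,q)$ is the group of matrices $x\in GL(n+1,q)$ with $x_{11}\ne 0$ and $x_{j1}=0$ for $j\ge2$. Rational canonical form data of $\alpha\in GL(m,q)$: for each monic irreducible polynomial $\phi\in\mathbb{F}_q[z]$, $\lambda_\phi=\lambda_\phi(\alpha)$ is the partition whose parts are the dimensions of the cyclic subspaces in a decomposition (under $\alpha$) of the $\phi$-primary component $V_\phi$ of $V=\mathbb{F}_q^m$; $\lambda_z$ is empty and $\sum_\phi|\lambda_\phi|\deg(\phi)=m$. For a partition $\lambda$: $m_i(\lambda)$ is the number of parts equal to $i$; $\lambda'$ is the conjugate partition, $\lambda'_i=m_i(\lambda)+m_{i+1}(\lambda)+\cdots$, so $\lambda'_1$ is the number of parts; $\lambda'_{\phi,i}$ denotes $(\lambda_\phi)'_i$. For $x$ and $i\ge0$, $(x)_i=(1-x)(1-x^2)\cdots(1-x^i)$ with $(x)_0=1$, so $(\frac1q)_i=\prod_{j=1}^i(1-q^{-j})$. *)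

theory Defs
  imports "Jordan_Normal_Form.Determinant" "HOL-Computational_Algebra.Polynomial"
    "HOL-Library.Multiset"
begin

text \<open>Matrices of size (n+1) x (n+1) over a finite field 'a (q = CARD('a)), indices 0..n;
  the paper's index 1 is our index 0.\<close>

definition GL :: "nat \<Rightarrow> 'a::field mat set" where
  "GL m = {x \<in> carrier_mat m m. det x \<noteq> 0}"

definition A_grp :: "nat \<Rightarrow> 'a::field mat set" where
  "A_grp n = {x \<in> GL (n+1). x $$ (0,0) = 1 \<and> (\<forall>j\<in>{1..n}. x $$ (j,0) = 0)}"

definition P_grp :: "nat \<Rightarrow> 'a::field mat set" where
  "P_grp n = {x \<in> GL (n+1). x $$ (0,0) \<noteq> 0 \<and> (\<forall>j\<in>{1..n}. x $$ (j,0) = 0)}"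

definition poly_act :: "'a::field mat \<Rightarrow> 'a poly \<Rightarrow> 'a vec \<Rightarrow> 'a vec" where
  "poly_act x p v = vec (dim_vec v) (\<lambda>r. \<Sum>i\<le>degree p. coeff p i * ((x ^\<^sub>m i) *\<^sub>v v) $ r)"

definition monic_irred :: "'a::field poly \<Rightarrow> bool" where
  "monic_irred p \<longleftrightarrow> lead_coeff p = 1 \<and> irreducible p"

text \<open>A primary cyclic decomposition of V = F^m under x: a list of triples (v, phi, k)
  with phi monic irreducible, k \<ge> 1, phi(x)^k v = 0, such that the vectors
  x^t v (t < k deg phi), over all triples, form a basis of V.  Each triple gives the
  cyclic subspace spanned by v, contained in the phi-primary component, whose dimension
  is k deg phi.\<close>
definition cyc_vectors :: "'a::field mat \<Rightarrow> ('a vec \<times> 'a poly \<times> nat) list \<Rightarrow> 'a vec list" where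
  "cyc_vectors x ds = concat (map (\<lambda>(v,p,k). map (\<lambda>t. (x ^\<^sub>m t) *\<^sub>v v) [0..<k * degree p]) ds)"

definition cyclic_decomp :: "nat \<Rightarrow> 'a::field mat \<Rightarrow> ('a vec \<times> 'a poly \<times> nat) list \<Rightarrow> bool" where
  "cyclic_decomp m x ds \<longleftrightarrow>
     (\<forall>(v,p,k) \<in> set ds. v \<in> carrier_vec m \<and> monic_irred p \<and> k \<ge> 1 \<and>
        poly_act x (p ^ k) v = 0\<^sub>v m) \<and>
     length (cyc_vectors x ds) = m \<and> det (mat_of_cols m (cyc_vectors x ds)) \<noteq> 0"

text \<open>Rational canonical form data: lambda_phi as a multiset of parts (partition),
  the parts being the sizes k of the cyclic summands (of dimension k deg phi).\<close>
definition rcf_data :: "nat \<Rightarrow> 'a::field mat \<Rightarrow> 'a poly \<Rightarrow> nat multiset" where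
  "rcf_data m x = (let ds = (SOME ds. cyclic_decomp m x ds) in
     (\<lambda>p. mset (map (\<lambda>(v,p',k). k) (filter (\<lambda>(v,p',k). p' = p) ds))))"

definition part_mult :: "nat multiset \<Rightarrow> nat \<Rightarrow> nat" where
  "part_mult lam i = count lam i"

definition part_conj :: "nat multiset \<Rightarrow> nat \<Rightarrow> nat" where
  "part_conj lam i = size (filter_mset (\<lambda>k. i \<le> k) lam)"

definition qpoch :: "real \<Rightarrow> nat \<Rightarrow> real" where
  "qpoch x i = (\<Prod>j\<in>{1..i}. 1 - x ^ j)"

text \<open>The common denominator: product over monic irreducible phi \<noteq> z; the factor for
  phi with empty lambda_phi is 1, so we range over the finitely many phi with nonempty
  lambda_phi.  Sums/products over i range over 1..|lambda_phi| (beyond that, terms vanish).\<close>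
definition rcf_denom :: "real \<Rightarrow> ('a::field poly \<Rightarrow> nat multiset) \<Rightarrow> real" where
  "rcf_denom q lam = (\<Prod>p \<in> {p. monic_irred p \<and> p \<noteq> [:0,1:] \<and> lam p \<noteq> {#}}.
      q ^ (degree p * (\<Sum>i\<in>{1..sum_mset (lam p)}. (part_conj (lam p) i)^2)) *
      (\<Prod>i\<in>{1..sum_mset (lam p)}. qpoch (1 / q ^ degree p) (part_mult (lam p) i)))"

end

theory Submission
  imports Defs "HOL-Computational_Algebra.Polynomial_Factorial" "HOL-Library.Cardinality"
begin

text \<open>
  A matrix makes \<open>F\<^sup>m\<close> a finite torsion module over \<open>F[z]\<close>. Generators \<open>v\<^sub>1, v\<^sub>2, \<dots>\<close> annihilated
  by \<open>p\<^sub>i\<^bsup>k\<^sub>i\<^esup>\<close> span a direct sum of cyclic modules of full length iff \<open>p\<^sub>i\<^bsup>k\<^sub>i-1\<^esup> v\<^sub>i\<close> never lies in the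
  span of the generators chosen before. Choosing greedily with decreasing exponents produces a
  primary cyclic decomposition, and the sizes of the kernels of the \<open>p\<^bsup>j\<^esup>\<close> determine the exponents.
  Counting the choices gives
  \<open>\<Prod>\<^sub>i (|ker p\<^sub>i\<^bsup>k\<^sub>i\<^esup>| - |ker p\<^sub>i\<^bsup>k\<^sub>i-1\<^esup>| q\<^bsup>c\<^sub>i deg p\<^sub>i\<^esup>)\<close>
  decompositions with the given exponents, where \<open>c\<^sub>i\<close> is the number of previous generators for
  \<open>p\<^sub>i\<close>; this is the denominator of the theorem.

  Sending a matrix with a decomposition to the matrix of the resulting basis is a bijection onto the
  whole general linear group, so the class with given data has \<open>|GL|\<close> divided by that many elements.
  Finally \<open>GL\<close> is transitive on nonzero vectors, so counting the pairs of a matrix in the class and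
  a nonzero eigenvector for \<open>a\<close> in two ways gives the number of matrices in the class with \<open>a e\<^sub>0\<close> as
  first column.
\<close>

section \<open>Polynomials over a field\<close>

lemma two_le_card_field: "2 \<le> CARD('a::{finite,zero_neq_one})"
  using card_mono[of "UNIV :: 'a set" "{0, 1}"] by simp

lemma euclidean_ring_bezout:
  fixes a b :: "'a::euclidean_ring"
  obtains d s t where "d = s * a + t * b" "d dvd a" "d dvd b"
proof (induction "euclidean_size b" arbitrary: a b thesis rule: less_induct)
  case less
  show ?case
  proof (cases "b = 0")
    case True
    then show ?thesis using less.prems[of a 1 0] by simp
  next
    case False
    then have "euclidean_size (a mod b) < euclidean_size b" by (rule mod_size_less)
    then obtain d s t where d: "d = s * b + t * (a mod b)" "d dvd b" "d dvd a mod b"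
      by (rule less.hyps)
    have "d = t * a + (s - t * (a div b)) * b"
      by (simp add: d(1) minus_div_mult_eq_mod[symmetric] algebra_simps)
    then show ?thesis using d(2,3) by (meson dvd_mod_imp_dvd less.prems)
  qed
qed

lemma prime_elem_power_dvd_mult_iff:
  fixes p :: "'a::algebraic_semidom"
  assumes "prime_elem p" "\<not> p dvd a"
  shows "p ^ n dvd a * b \<longleftrightarrow> p ^ n dvd b"
  using prime_elem_power_dvd_cases[of p n a b 1 n] assms by auto

lemma bezout_not_power_dvd:
  fixes p f :: "'a::euclidean_ring"
  assumes p: "prime_elem p" and f: "\<not> p ^ k dvd f"
  obtains s t where "s * f + t * p ^ k = p ^ (k - 1)"
proof -
  obtain d s t where d: "d = s * f + t * p ^ k" "d dvd f" "d dvd p ^ k"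
    using euclidean_ring_bezout .
  obtain e where e: "p ^ k = d * e" using d(3) by blast
  have "p dvd e"
  proof (rule ccontr)
    assume "\<not> p dvd e"
    then have "p ^ k dvd d"
      using prime_elem_power_dvd_mult_iff[OF p, of e k d] by (simp add: e mult.commute)
    then show False using d(2) f dvd_trans by blast
  qed
  then obtain c where "e = p * c" by blast
  then have "p * (c * d) = d * e" by (simp add: mult_ac)
  also have "\<dots> = p * p ^ (k - 1)" unfolding e[symmetric] using f by (cases k) auto
  finally have "p ^ (k - 1) = c * d" using p by (simp add: prime_elem_def)
  also have "\<dots> = (c * s) * f + (c * t) * p ^ k" by (simp add: d(1) algebra_simps)
  finally show ?thesis using that by metis
qed

lemma bezout_prime_power:
  fixes p g :: "'a::euclidean_ring"
  assumes p: "prime_elem p" and g: "\<not> p dvd g"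
  obtains s t where "s * p ^ k + t * g = 1"
proof -
  obtain d s t where d: "d = s * p ^ k + t * g" "d dvd p ^ k" "d dvd g"
    using euclidean_ring_bezout .
  have "\<not> p dvd d" using d(3) g dvd_trans by blast
  moreover obtain e where e: "p ^ k = d * e" using d(2) by blast
  ultimately have "p ^ k dvd e" using prime_elem_power_dvd_mult_iff[OF p, of d k e] by simp
  then obtain c where "e = p ^ k * c" by blast
  then have "p ^ k * (c * d) = d * e" by (simp add: mult_ac)
  then have "p ^ k * (c * d) = p ^ k * 1" by (simp only: e mult_1_right)
  then have "c * d = 1" using p by (subst (asm) mult_cancel_left) (simp add: prime_elem_def)
  then have "(c * s) * p ^ k + (c * t) * g = 1" using d(1) by (simp add: algebra_simps)
  then show ?thesis using that by blast
qed

lemma poly_split_off_power: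
  fixes p f :: "'a::field poly"
  assumes "0 < degree p" "f \<noteq> 0"
  obtains i g where "f = p ^ i * g" "\<not> p dvd g"
  using assms(2)
proof (induction "degree f" arbitrary: f thesis rule: less_induct)
  case less
  show ?case
  proof (cases "p dvd f")
    case True
    then obtain h where h: "f = p * h" by blast
    then have "h \<noteq> 0" "degree h < degree f"
      using less.prems(2) assms(1) by (auto simp: degree_mult_eq)
    then obtain i g where "h = p ^ i * g" "\<not> p dvd g" using less.hyps by blast
    then show ?thesis using less.prems(1)[of "Suc i" g] h by (simp add: mult.assoc)
  next
    case False
    then show ?thesis using less.prems(1)[of 0 f] by simp
  qed
qed

lemma monic_irred_prime_elem: "monic_irred p \<Longrightarrow> prime_elem p"
  by (simp add: monic_irred_def field_poly_irreducible_imp_prime)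

lemma monic_irred_nonzero: "monic_irred p \<Longrightarrow> p \<noteq> 0"
  by (auto simp: monic_irred_def)

lemma monic_irred_degree_pos: "monic_irred p \<Longrightarrow> 0 < degree p"
  using is_unit_iff_degree[OF monic_irred_nonzero] irreducible_not_unit
  unfolding monic_irred_def by blast

lemma monic_irred_degree_power: "monic_irred p \<Longrightarrow> degree (p ^ k) = k * degree p"
  by (simp add: degree_power_eq monic_irred_nonzero)

lemma monic_irred_linear: "monic_irred [:a, 1:]"
  by (simp add: monic_irred_def irreducible_linear_field_poly)

lemma monic_irred_dvd_imp_eq:
  assumes p: "monic_irred p" and r: "monic_irred r" and dvd: "p dvd r"
  shows "p = r"
proof -
  have "\<not> is_unit p" "irreducible r" using p r by (auto simp: monic_irred_def irreducible_not_unit)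
  then obtain c where c: "r = p * c" "is_unit c" using dvd irreducibleD by blast
  then obtain a where "c = [:a:]" by (metis is_unit_polyE)
  moreover have "lead_coeff r = lead_coeff p * lead_coeff c" by (simp only: c(1) lead_coeff_mult)
  ultimately have "c = 1" using p r by (simp add: monic_irred_def)
  then show ?thesis using c(1) by simp
qed

lemma monic_irred_not_dvd_power:
  assumes "monic_irred p" "monic_irred r" "p \<noteq> r"
  shows "\<not> p dvd r ^ k"
  using assms monic_irred_dvd_imp_eq prime_elem_dvd_power[OF monic_irred_prime_elem] by blast

lemma monic_irred_divisor_exists:
  fixes f :: "'a::field poly"
  assumes "0 < degree f"
  obtains p where "monic_irred p" "p dvd f"
  using assms
proof (induction "degree f" arbitrary: f thesis rule: less_induct)
  case less
  have f: "f \<noteq> 0" "\<not> is_unit f" using less.prems(2) is_unit_iff_degree[of f] by force+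
  show ?case
  proof (cases "irreducible f")
    case True
    let ?p = "smult (inverse (lead_coeff f)) f"
    have "irreducible ([:inverse (lead_coeff f):] * f)"
      using f(1) True by (subst irreducible_mult_unit_left) (simp_all add: is_unit_triv)
    then have "monic_irred ?p" using f(1) by (simp add: monic_irred_def)
    then show ?thesis using less.prems(1) f(1) by (simp add: smult_dvd_iff)
  next
    case False
    then obtain a b where ab: "f = a * b" "\<not> is_unit a" "\<not> is_unit b"
      using f by (auto simp: irreducible_def)
    then have "a \<noteq> 0" "b \<noteq> 0" using f(1) by auto
    then have "0 < degree a" "degree a < degree f"
      using ab by (auto simp: is_unit_iff_degree degree_mult_eq)
    then obtain p where "monic_irred p" "p dvd a" using less.hyps by blast
    then show ?thesis using less.prems(1) ab(1) by (meson dvd_mult2)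
  qed
qed

definition polys_below :: "nat \<Rightarrow> 'a::zero poly set" where
  "polys_below n = {f. f = 0 \<or> degree f < n}"

lemma polys_below_iff_coeff: "f \<in> polys_below n \<longleftrightarrow> (\<forall>i\<ge>n. coeff f i = 0)"
  unfolding polys_below_def
  by (auto simp: coeff_eq_0) (metis leading_coeff_0_iff not_le)

lemma polys_below_diff: "f \<in> polys_below n \<Longrightarrow> g \<in> polys_below n \<Longrightarrow> f - g \<in> polys_below n"
  for f :: "'a::ab_group_add poly"
  by (simp add: polys_below_iff_coeff)

lemma mod_in_polys_below: "g \<noteq> 0 \<Longrightarrow> f mod g \<in> polys_below (degree g)"
  for f :: "'a::field poly"
  using degree_mod_less[of g f] by (auto simp: polys_below_def)

lemma polys_below_Suc: "polys_below (Suc n) = (\<lambda>(a, f). pCons a f) ` (UNIV \<times> polys_below n)"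
proof (intro subset_antisym subsetI)
  fix f :: "'a poly" assume f: "f \<in> polys_below (Suc n)"
  obtain a g where fg: "f = pCons a g" by (cases f)
  have "coeff g i = coeff f (Suc i)" for i by (simp add: fg)
  then have "g \<in> polys_below n" using f by (simp add: polys_below_iff_coeff)
  then show "f \<in> (\<lambda>(a, f). pCons a f) ` (UNIV \<times> polys_below n)"
    by (auto simp: fg)
qed (auto simp: polys_below_iff_coeff coeff_pCons split: nat.split)

lemma finite_polys_below: "finite (polys_below n :: 'a::{finite,zero} poly set)"
proof (induction n)
  case 0
  then show ?case by (simp add: polys_below_def)
qed (simp add: polys_below_Suc)

lemma card_polys_below: "card (polys_below n :: 'a::{finite,zero} poly set) = CARD('a) ^ n"
proof (induction n)
  case 0
  then show ?case by (simp add: polys_below_def)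
next
  case (Suc n)
  have "inj_on (\<lambda>(a, f). pCons a f) (UNIV \<times> (polys_below n :: 'a poly set))"
    by (auto simp: inj_on_def)
  then show ?case using Suc by (simp add: polys_below_Suc card_image card_cartesian_product)
qed

lemma card_multiples_below:
  fixes g :: "'a::{finite,field} poly"
  assumes "g \<noteq> 0"
  shows "card {f \<in> polys_below (degree g + n). g dvd f} = CARD('a) ^ n"
proof -
  have "g * f \<in> polys_below (degree g + n) \<longleftrightarrow> f \<in> polys_below n" for f
    using assms by (cases "f = 0") (auto simp: polys_below_def degree_mult_eq)
  then have "{f \<in> polys_below (degree g + n). g dvd f} = (*) g ` polys_below n"
    by (auto elim!: dvdE)
  moreover have "inj_on ((*) g) (polys_below n)" using assms by (auto simp: inj_on_def)
  ultimately show ?thesis by (simp add: card_image card_polys_below)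
qed

lemma power_dvd_power_mult_iff:
  fixes p f :: "'a::idom_divide"
  assumes "p \<noteq> 0"
  shows "p ^ k dvd p ^ j * f \<longleftrightarrow> p ^ (k - min j k) dvd f"
proof (cases "j \<le> k")
  case True
  then have "p ^ k = p ^ j * p ^ (k - j)" by (simp flip: power_add)
  then show ?thesis using True assms by simp
next
  case False
  then show ?thesis using le_imp_power_dvd[of k j p] by (simp add: dvd_mult2)
qed

lemma card_power_annihilator:
  fixes p P :: "'a::{finite,field} poly"
  assumes p: "monic_irred p" and P: "monic_irred P"
  shows "card {f \<in> polys_below (k * degree p). p ^ k dvd P ^ j * f}
    = CARD('a) ^ (if p = P then degree P * min j k else 0)"
proof (cases "p = P")
  case True
  have "k * degree p = degree (p ^ (k - min j k)) + degree p * min j k"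
    unfolding monic_irred_degree_power[OF p] by (simp add: algebra_simps flip: add_mult_distrib)
  then show ?thesis
    using card_multiples_below[of "p ^ (k - min j k)" "degree p * min j k"]
      monic_irred_nonzero[OF p] True
    by (simp add: power_dvd_power_mult_iff)
next
  case False
  have "p ^ k dvd P ^ j * f \<longleftrightarrow> p ^ k dvd f" for f
    using prime_elem_power_dvd_mult_iff monic_irred_prime_elem[OF p]
      monic_irred_not_dvd_power[OF p P False] by blast
  then show ?thesis
    using card_multiples_below[of "p ^ k" 0] monic_irred_nonzero[OF p] False
    by (simp add: monic_irred_degree_power[OF p])
qed

section \<open>Partitions\<close>

lemma part_conj_empty [simp]: "part_conj {#} i = 0"
  and part_conj_add_mset [simp]:
    "part_conj (add_mset k M) i = (if i \<le> k then Suc (part_conj M i) else part_conj M i)"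
  by (simp_all add: part_conj_def)

lemma part_conj_eq_count_plus: "part_conj M i = count M i + part_conj M (Suc i)"
  by (induction M) auto

lemma part_conj_eq_count_if_le: "(\<And>j. j \<in># M \<Longrightarrow> j \<le> k) \<Longrightarrow> part_conj M k = count M k"
  by (induction M) (auto simp: le_antisym)

lemma part_conj_eq_size_if_ge: "(\<And>j. j \<in># M \<Longrightarrow> k \<le> j) \<Longrightarrow> part_conj M k = size M"
  by (induction M) auto

definition column_sum :: "nat multiset \<Rightarrow> nat \<Rightarrow> nat" where
  "column_sum M j = (\<Sum>i\<in>{1..j}. part_conj M i)"

lemma column_sum_empty [simp]: "column_sum {#} j = 0"
  by (simp add: column_sum_def)

lemma column_sum_add_mset [simp]: "column_sum (add_mset k M) j = min j k + column_sum M j"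
proof -
  have "column_sum (add_mset k M) j = (\<Sum>i\<in>{1..j}. (if i \<le> k then 1 else 0) + part_conj M i)"
    unfolding column_sum_def by (rule sum.cong) auto
  also have "\<dots> = card ({1..j} \<inter> {i. i \<le> k}) + column_sum M j"
    by (simp add: sum.distrib sum.If_cases column_sum_def)
  also have "{1..j} \<inter> {i. i \<le> k} = {1..min j k}" by auto
  finally show ?thesis by simp
qed

lemma column_sum_Suc: "column_sum M (Suc j) = column_sum M j + part_conj M (Suc j)"
  by (simp add: column_sum_def)

lemma column_sum_Suc_0 [simp]: "column_sum M (Suc 0) = part_conj M (Suc 0)"
  by (simp add: column_sum_def)

lemma partition_eqI:
  assumes "0 \<notin># M" "0 \<notin># N" and column_sums: "\<And>j. column_sum M j = column_sum N j"
  shows "M = N"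
proof (rule multiset_eqI)
  have columns: "part_conj M (Suc i) = part_conj N (Suc i)" for i
    using column_sums[of i] column_sums[of "Suc i"] by (simp add: column_sum_Suc)
  show "count M k = count N k" for k
  proof (cases k)
    case 0
    then show ?thesis using assms(1,2) by (simp add: not_in_iff)
  next
    case (Suc i)
    then show ?thesis
      using part_conj_eq_count_plus[of M k] part_conj_eq_count_plus[of N k] columns by simp
  qed
qed

lemma sum_mset_column_weights:
  fixes c :: "nat \<Rightarrow> nat"
  assumes "\<And>k. k \<in># M \<Longrightarrow> k \<le> b"
  shows "(\<Sum>k\<in>#M. \<Sum>i\<in>{1..k}. c i) = (\<Sum>i\<in>{1..b}. part_conj M i * c i)"
  using assms
proof (induction M)
  case (add k M)
  have "(\<Sum>i\<in>{1..b}. part_conj (add_mset k M) i * c i)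
      = (\<Sum>i\<in>{1..b}. (if i \<le> k then c i else 0) + part_conj M i * c i)"
    by (rule sum.cong) auto
  also have "\<dots> = (\<Sum>i\<in>{1..b} \<inter> {i. i \<le> k}. c i) + (\<Sum>k\<in>#M. \<Sum>i\<in>{1..k}. c i)"
    using add by (simp add: sum.distrib sum.If_cases)
  also have "{1..b} \<inter> {i. i \<le> k} = {1..k}" using add.prems[of k] by auto
  finally show ?case by simp
qed simp

lemma sum_mset_column_sum:
  "(\<Sum>k\<in>#M. column_sum M k) = (\<Sum>i\<in>{1..\<Sum>\<^sub># M}. (part_conj M i)\<^sup>2)"
proof -
  have "k \<le> \<Sum>\<^sub># M" if "k \<in># M" for k using multi_member_split[OF that] by auto
  then have "(\<Sum>k\<in>#M. column_sum M k) = (\<Sum>i\<in>{1..\<Sum>\<^sub># M}. part_conj M i * part_conj M i)"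
    unfolding column_sum_def by (rule sum_mset_column_weights)
  then show ?thesis by (simp only: power2_eq_square)
qed

lemma qpoch_0 [simp]: "qpoch x 0 = 1"
  by (simp add: qpoch_def)

lemma qpoch_Suc: "qpoch x (Suc n) = qpoch x n * (1 - x ^ Suc n)"
  by (simp add: qpoch_def)

lemma prod_prefix_count_qpoch:
  fixes x :: "'d \<Rightarrow> real"
  assumes "finite A" "set xs \<subseteq> A"
  shows "(\<Prod>i<length xs. 1 - x (xs ! i) ^ Suc (count (mset (take i xs)) (xs ! i)))
    = (\<Prod>d\<in>A. qpoch (x d) (count (mset xs) d))"
  using assms(2)
proof (induction xs rule: rev_induct)
  case (snoc d xs)
  let ?c = "count (mset xs)"
  have "(\<Prod>i<length (xs @ [d]). 1 - x ((xs @ [d]) ! i) ^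
        Suc (count (mset (take i (xs @ [d]))) ((xs @ [d]) ! i)))
      = (1 - x d ^ Suc (?c d)) * (\<Prod>e\<in>A. qpoch (x e) (?c e))"
    using snoc by (simp add: nth_append)
  also have "\<dots> = (1 - x d ^ Suc (?c d)) * qpoch (x d) (?c d) * (\<Prod>e\<in>A - {d}. qpoch (x e) (?c e))"
    using snoc.prems by (subst prod.remove[OF assms(1), of d]) simp_all
  also have "\<dots> = qpoch (x d) (Suc (?c d)) * (\<Prod>e\<in>A - {d}. qpoch (x e) (count (mset (xs @ [d])) e))"
    by (intro arg_cong2[where f = "(*)"] prod.cong) (auto simp: qpoch_Suc)
  also have "\<dots> = (\<Prod>e\<in>A. qpoch (x e) (count (mset (xs @ [d])) e))"
    using snoc.prems by (subst prod.remove[OF assms(1), of d]) simp_all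
  finally show ?case .
qed simp

section \<open>Lists of elementary divisors\<close>

text \<open>An entry \<open>(p, k)\<close> stands for the elementary divisor \<open>p\<^bsup>k\<^esup>\<close>.\<close>

definition divisors_degree :: "('a::zero poly \<times> nat) list \<Rightarrow> nat" where
  "divisors_degree L = (\<Sum>(p, k)\<leftarrow>L. k * degree p)"

definition divisor_partition :: "('a \<times> nat) list \<Rightarrow> 'a \<Rightarrow> nat multiset" where
  "divisor_partition L p = mset (map snd (filter (\<lambda>d. fst d = p) L))"

lemma divisors_degree_Nil [simp]: "divisors_degree [] = 0"
  and divisors_degree_Cons [simp]:
    "divisors_degree ((p, k) # L) = k * degree p + divisors_degree L"
  by (simp_all add: divisors_degree_def)

lemma divisor_partition_Nil [simp]: "divisor_partition [] p = {#}"
  and divisor_partition_Cons [simp]: "divisor_partition ((p, k) # L) r =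
    (if p = r then add_mset k (divisor_partition L r) else divisor_partition L r)"
  by (simp_all add: divisor_partition_def)

lemma divisor_partition_append [simp]:
  "divisor_partition (L @ L') p = divisor_partition L p + divisor_partition L' p"
  by (simp add: divisor_partition_def)

lemma count_divisor_partition: "count (divisor_partition L p) k = count (mset L) (p, k)"
  by (induction L) (auto split: if_splits)

lemma in_divisor_partition_iff: "k \<in># divisor_partition L p \<longleftrightarrow> (p, k) \<in> set L"
  by (force simp: divisor_partition_def)

lemma divisor_partition_empty_iff: "divisor_partition L p = {#} \<longleftrightarrow> p \<notin> fst ` set L"
  by (force simp: divisor_partition_def filter_empty_conv)

lemma mset_eq_iff_divisor_partition_eq:
  "mset L = mset L' \<longleftrightarrow> divisor_partition L = divisor_partition L'"
  unfolding multiset_eq_iff fun_eq_iff by (simp add: count_divisor_partition)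

lemma divisors_degree_mset_cong: "mset L = mset L' \<Longrightarrow> divisors_degree L = divisors_degree L'"
  unfolding divisors_degree_def by (simp flip: sum_mset_sum_list)

lemma sum_list_by_divisor_partition:
  fixes f :: "'a \<Rightarrow> nat \<Rightarrow> 'b::comm_monoid_add"
  assumes "finite S" "fst ` set L \<subseteq> S"
  shows "(\<Sum>(p, k)\<leftarrow>L. f p k) = (\<Sum>p\<in>S. \<Sum>k\<in>#divisor_partition L p. f p k)"
  using assms(2)
proof (induction L)
  case (Cons d L)
  obtain p k where d: "d = (p, k)" by (cases d)
  have "(\<Sum>r\<in>S. \<Sum>j\<in>#divisor_partition (d # L) r. f r j)
      = (\<Sum>r\<in>S. (if p = r then f p k else 0) + (\<Sum>j\<in>#divisor_partition L r. f r j))"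
    by (rule sum.cong) (auto simp: d)
  then show ?case using Cons d assms(1) by (simp add: sum.distrib)
qed simp

section \<open>Families of generators in modules over the polynomial ring\<close>

text \<open>A triple \<open>(v, p, k)\<close> in a family stands for the cyclic submodule generated by \<open>v\<close>, whose order
  should be \<open>p\<^bsup>k\<^esup>\<close>.\<close>

locale poly_module = Modules.module scale
  for scale :: "'a::{finite,field} poly \<Rightarrow> 'v::ab_group_add \<Rightarrow> 'v" (infixr \<open>*s\<close> 75)
begin

definition family_span :: "('v \<times> 'a poly \<times> nat) list \<Rightarrow> 'v set" where
  "family_span ds = span (fst ` set ds)"

definition primary_family :: "('v \<times> 'a poly \<times> nat) list \<Rightarrow> bool" where
  "primary_family ds \<longleftrightarrow> (\<forall>(v, p, k)\<in>set ds. monic_irred p \<and> 1 \<le> k \<and> p ^ k *s v = 0)"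

fun direct_family :: "('v \<times> 'a poly \<times> nat) list \<Rightarrow> bool" where
  "direct_family [] \<longleftrightarrow> True"
| "direct_family ((v, p, k) # ds) \<longleftrightarrow> monic_irred p \<and> 1 \<le> k \<and> p ^ k *s v = 0 \<and>
    p ^ (k - 1) *s v \<notin> family_span ds \<and> direct_family ds"

lemmas family_induct = direct_family.induct [case_names Nil Cons]

lemma primary_family_Nil [simp]: "primary_family []"
  and primary_family_Cons [simp]: "primary_family ((v, p, k) # ds) \<longleftrightarrow>
    monic_irred p \<and> 1 \<le> k \<and> p ^ k *s v = 0 \<and> primary_family ds"
  by (auto simp: primary_family_def)

lemma direct_imp_primary_family: "direct_family ds \<Longrightarrow> primary_family ds"
  by (induction ds rule: family_induct) auto

lemma dvd_annihilates: "g dvd f \<Longrightarrow> g *s v = 0 \<Longrightarrow> f *s v = 0"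
  by (metis dvd_def mult.commute scale_scale scale_zero_right)

lemma subspace_family_span: "subspace (family_span ds)"
  by (simp add: family_span_def)

lemma family_span_Nil [simp]: "family_span [] = {0}"
  by (simp add: family_span_def)

lemma family_span_subset: "subspace V \<Longrightarrow> fst ` set ds \<subseteq> V \<Longrightarrow> family_span ds \<subseteq> V"
  unfolding family_span_def by (rule span_minimal)

lemma family_span_Cons_mono: "family_span ds \<subseteq> family_span (d # ds)"
  unfolding family_span_def by (rule span_mono) auto

lemma family_span_Cons:
  "family_span ((v, p, k) # ds) = (\<lambda>(f, w). f *s v + w) ` (UNIV \<times> family_span ds)"
proof -
  have "x - f *s v \<in> W \<longleftrightarrow> (\<exists>w\<in>W. x = f *s v + w)" for x f W
    by (auto simp: algebra_simps) (metis add_diff_cancel_left' diff_add_cancel add.commute)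
  then show ?thesis by (auto simp: family_span_def span_insert)
qed

lemma family_span_Cons_below:
  assumes g: "g \<noteq> 0" "g *s v \<in> family_span ds"
  shows "family_span ((v, p, k) # ds)
    = (\<lambda>(f, w). f *s v + w) ` (polys_below (degree g) \<times> family_span ds)"
proof -
  have "\<exists>f'\<in>polys_below (degree g). \<exists>w'\<in>family_span ds. f *s v + w = f' *s v + w'"
    if w: "w \<in> family_span ds" for f w
  proof (intro bexI)
    have "f *s v - (f mod g) *s v = (f - f mod g) *s v" by (simp add: scale_left_diff_distrib)
    also have "\<dots> = (f div g) *s g *s v" by (simp add: minus_mod_eq_div_mult)
    finally have "f *s v - (f mod g) *s v \<in> family_span ds"
      using subspace_scale[OF subspace_family_span g(2), of "f div g"] by simp
    then show "f *s v - (f mod g) *s v + w \<in> family_span ds"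
      using w by (rule subspace_add[OF subspace_family_span])
    show "f mod g \<in> polys_below (degree g)" using g(1) by (rule mod_in_polys_below)
  qed simp
  then show ?thesis unfolding family_span_Cons by (auto simp: image_iff)
qed

lemma family_span_Cons_primary:
  assumes "monic_irred p" "p ^ k *s v = 0"
  shows "family_span ((v, p, k) # ds)
    = (\<lambda>(f, w). f *s v + w) ` (polys_below (k * degree p) \<times> family_span ds)"
  using family_span_Cons_below[of "p ^ k" v ds p k] assms subspace_0[OF subspace_family_span]
  by (simp add: monic_irred_nonzero monic_irred_degree_power)

lemma direct_family_Cons_dvd:
  assumes d: "direct_family ((v, p, k) # ds)" and f: "f *s v \<in> family_span ds"
  shows "p ^ k dvd f"
proof (rule ccontr)
  assume "\<not> p ^ k dvd f"
  then obtain s t where st: "s * f + t * p ^ k = p ^ (k - 1)"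
    using d bezout_not_power_dvd[OF monic_irred_prime_elem, of p k f] by auto
  have "p ^ (k - 1) *s v = (s * f + t * p ^ k) *s v" by (simp only: st)
  also have "\<dots> = s *s f *s v + t *s p ^ k *s v" by (simp add: scale_left_distrib)
  also have "\<dots> = s *s f *s v" using d by (simp del: scale_scale)
  finally show False using d subspace_scale[OF subspace_family_span f, of s] by simp
qed

lemma direct_family_Cons_inj:
  assumes d: "direct_family ((v, p, k) # ds)"
  shows "inj_on (\<lambda>(f, w). f *s v + w) (polys_below (k * degree p) \<times> family_span ds)"
proof (rule inj_onI, clarify)
  fix f w f' w'
  assume f: "f \<in> polys_below (k * degree p)" "f' \<in> polys_below (k * degree p)"
    and w: "w \<in> family_span ds" "w' \<in> family_span ds" and eq: "f *s v + w = f' *s v + w'"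
  have "(f - f') *s v = w' - w" using eq by (simp add: algebra_simps)
  then have "p ^ k dvd f - f'"
    using direct_family_Cons_dvd[OF d] subspace_diff[OF subspace_family_span] w by metis
  moreover have "f - f' \<in> polys_below (degree (p ^ k))"
    using polys_below_diff[OF f] d by (simp add: monic_irred_degree_power)
  ultimately have "f - f' = 0"
    using dvd_imp_degree_le[of "p ^ k" "f - f'"] by (auto simp: polys_below_def simp flip: not_le)
  then show "f = f' \<and> w = w'" using eq by simp
qed

lemma direct_family_Cons_annihilated:
  assumes d: "direct_family ((v, p, k) # ds)" and w: "w \<in> family_span ds"
    and g: "g *s (f *s v + w) = 0"
  shows "p ^ k dvd g * f" "g *s w = 0"
proof -
  have "(g * f) *s v = - (g *s w)"
    using g by (simp add: scale_right_distrib eq_neg_iff_add_eq_0)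
  moreover have "- (g *s w) \<in> family_span ds"
    using w by (intro subspace_neg subspace_scale subspace_family_span)
  ultimately show dvd: "p ^ k dvd g * f" using direct_family_Cons_dvd[OF d] by simp
  then have "(g * f) *s v = 0" using d dvd_annihilates by simp
  then show "g *s w = 0" using g by (simp add: scale_right_distrib)
qed

lemma card_family_span_Cons_le:
  assumes p: "monic_irred p" and "p ^ j *s v \<in> family_span ds" and fin: "finite (family_span ds)"
  shows "finite (family_span ((v, p, k) # ds))"
    "card (family_span ((v, p, k) # ds)) \<le> CARD('a) ^ (j * degree p) * card (family_span ds)"
proof -
  let ?D = "(polys_below (j * degree p) :: 'a poly set) \<times> family_span ds"
  have span: "family_span ((v, p, k) # ds) = (\<lambda>(f, w). f *s v + w) ` ?D"
    using family_span_Cons_below[of "p ^ j" v ds p k] assms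
    by (simp add: monic_irred_nonzero monic_irred_degree_power)
  have "finite ?D" using finite_polys_below fin by (rule finite_cartesian_product)
  then show "finite (family_span ((v, p, k) # ds))"
    "card (family_span ((v, p, k) # ds)) \<le> CARD('a) ^ (j * degree p) * card (family_span ds)"
    unfolding span using card_image_le[of ?D "\<lambda>(f, w). f *s v + w"]
    by (simp_all add: card_cartesian_product card_polys_below)
qed

lemma finite_family_span: "primary_family ds \<Longrightarrow> finite (family_span ds)"
proof (induction ds rule: family_induct)
  case (Cons v p k ds)
  then show ?case
    using card_family_span_Cons_le(1)[of p k v ds k] subspace_0[OF subspace_family_span] by simp
qed simp

lemma card_family_span_le:
  "primary_family ds \<Longrightarrow> card (family_span ds) \<le> CARD('a) ^ divisors_degree (map snd ds)"
proof (induction ds rule: family_induct)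
  case (Cons v p k ds)
  have "card (family_span ((v, p, k) # ds)) \<le> CARD('a) ^ (k * degree p) * card (family_span ds)"
    using Cons.prems card_family_span_Cons_le(2)[of p k v ds k] subspace_0[OF subspace_family_span]
    by (simp add: finite_family_span)
  also have "\<dots> \<le> CARD('a) ^ (k * degree p) * CARD('a) ^ divisors_degree (map snd ds)"
    using Cons by simp
  finally show ?case by (simp add: power_add)
qed simp

lemma card_direct_family_span:
  "direct_family ds \<Longrightarrow> card (family_span ds) = CARD('a) ^ divisors_degree (map snd ds)"
proof (induction ds rule: family_induct)
  case (Cons v p k ds)
  let ?D = "(polys_below (k * degree p) :: 'a poly set) \<times> family_span ds"
  have "card (family_span ((v, p, k) # ds)) = card ((\<lambda>(f, w). f *s v + w) ` ?D)"
    using Cons.prems by (simp add: family_span_Cons_primary)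
  also have "\<dots> = card ?D" using direct_family_Cons_inj[OF Cons.prems] by (rule card_image)
  finally show ?case using Cons by (simp add: card_cartesian_product card_polys_below power_add)
qed simp

lemma direct_familyI_card:
  assumes "primary_family ds" "card (family_span ds) = CARD('a) ^ divisors_degree (map snd ds)"
  shows "direct_family ds"
  using assms
proof (induction ds rule: family_induct)
  case (Cons v p k ds)
  let ?q = "CARD('a)"
  have p: "monic_irred p" "1 \<le> k" "p ^ k *s v = 0" and ds: "primary_family ds"
    using Cons.prems(1) by auto
  have card: "card (family_span ((v, p, k) # ds))
      = ?q ^ (k * degree p) * ?q ^ divisors_degree (map snd ds)"
    using Cons.prems(2) by (simp add: power_add)
  note fin = finite_family_span[OF ds]
  have "?q ^ divisors_degree (map snd ds) \<le> card (family_span ds)"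
    using card_family_span_Cons_le(2)[OF p(1) _ fin, of k v k] p(3)
      subspace_0[OF subspace_family_span]
    by (simp add: card)
  then have card_ds: "card (family_span ds) = ?q ^ divisors_degree (map snd ds)"
    using card_family_span_le[OF ds] by simp
  have "p ^ (k - 1) *s v \<notin> family_span ds"
  proof
    assume "p ^ (k - 1) *s v \<in> family_span ds"
    from card_family_span_Cons_le(2)[OF p(1) this fin, of k]
    have "?q ^ (k * degree p) \<le> ?q ^ ((k - 1) * degree p)" by (simp add: card card_ds)
    then have "k * degree p \<le> (k - 1) * degree p"
      using two_le_card_field[where 'a='a] by (simp add: power_increasing_iff)
    then show False using p(2) monic_irred_degree_pos[OF p(1)] by simp
  qed
  then show ?case using Cons.IH[OF ds card_ds] p by simp
qed simp

lemma card_direct_family_kernel: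
  assumes "direct_family ds" and P: "monic_irred P"
  shows "card {u \<in> family_span ds. P ^ j *s u = 0}
    = CARD('a) ^ (degree P * column_sum (divisor_partition (map snd ds) P) j)"
  using assms(1)
proof (induction ds rule: family_induct)
  case Nil
  have "{u \<in> family_span []. P ^ j *s u = 0} = {0}" by auto
  then show ?case by simp
next
  case (Cons v p k ds)
  have p: "monic_irred p" and pk: "p ^ k *s v = 0" using Cons by auto
  let ?F = "{f \<in> polys_below (k * degree p). p ^ k dvd P ^ j * f}"
  let ?K = "{u \<in> family_span ds. P ^ j *s u = 0}"
  have "P ^ j *s (f *s v + w) = 0 \<longleftrightarrow> p ^ k dvd P ^ j * f \<and> P ^ j *s w = 0"
    if "w \<in> family_span ds" for f w
    using direct_family_Cons_annihilated[OF Cons.prems that]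
      dvd_annihilates[of "p ^ k" "P ^ j * f" v] pk
    by (auto simp: scale_right_distrib)
  then have "{u \<in> family_span ((v, p, k) # ds). P ^ j *s u = 0} = (\<lambda>(f, w). f *s v + w) ` (?F \<times> ?K)"
    unfolding family_span_Cons_primary[OF p pk] by auto
  moreover have "inj_on (\<lambda>(f, w). f *s v + w) (?F \<times> ?K)"
    using direct_family_Cons_inj[OF Cons.prems] by (rule inj_on_subset) auto
  ultimately have "card {u \<in> family_span ((v, p, k) # ds). P ^ j *s u = 0} = card ?F * card ?K"
    by (simp add: card_image card_cartesian_product)
  then show ?case
    using Cons by (simp add: card_power_annihilator[OF p P] add_mult_distrib2 power_add)
qed

lemma direct_family_divide:
  assumes "direct_family ds" and P: "monic_irred P" and j: "1 \<le> j"
    "\<And>v k. (v, P, k) \<in> set ds \<Longrightarrow> j \<le> k" and "u \<in> family_span ds" "P *s u = 0"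
  shows "\<exists>w\<in>family_span ds. P ^ (j - 1) *s w = u"
  using assms(1,4-)
proof (induction ds arbitrary: u rule: family_induct)
  case (Cons v p k ds)
  obtain f w where fw: "w \<in> family_span ds" "u = f *s v + w"
    using Cons.prems(3) by (auto simp: family_span_Cons)
  note ann = direct_family_Cons_annihilated[OF Cons.prems(1) fw(1), of P f]
  obtain w' where w': "w' \<in> family_span ds" "P ^ (j - 1) *s w' = w"
    using Cons fw ann(2) by (auto dest: spec)
  have "\<exists>f'. P ^ (j - 1) *s f' *s v = f *s v"
  proof (cases "p = P")
    case True
    then have jk: "j \<le> k" using Cons.prems(2) by auto
    have "P ^ (k - 1) dvd f"
      using ann(1) Cons.prems(4) fw(2) True jk j(1) power_dvd_power_mult_iff[of P k 1 f]
        monic_irred_nonzero[OF P] by simp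
    then have "P ^ (j - 1) dvd f" using jk by (meson diff_le_mono dvd_trans le_imp_power_dvd)
    then obtain f' where "f = P ^ (j - 1) * f'" by blast
    then show ?thesis by (intro exI[of _ f']) simp
  next
    case False
    have p: "monic_irred p" using Cons.prems(1) by simp
    have "\<not> p dvd P" using monic_irred_not_dvd_power[OF p P False, of 1] by simp
    then have "p ^ k dvd f"
      using ann(1) Cons.prems(4) fw(2)
        prime_elem_power_dvd_mult_iff[OF monic_irred_prime_elem[OF p]] by blast
    then have "f *s v = 0" using dvd_annihilates Cons.prems(1) by auto
    then show ?thesis by (intro exI[of _ 0]) simp
  qed
  then obtain f' where "P ^ (j - 1) *s f' *s v = f *s v" by blast
  then have "P ^ (j - 1) *s (f' *s v + w') = u" using w' fw by (simp add: scale_right_distrib)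
  then show ?case using w'(1) unfolding family_span_Cons by force
qed auto

lemma length_le_divisors_degree: "primary_family ds \<Longrightarrow> length ds \<le> divisors_degree (map snd ds)"
proof (induction ds rule: family_induct)
  case (Cons v p k ds)
  then have "1 \<le> k * degree p" using monic_irred_degree_pos[of p] by (simp add: Suc_le_eq)
  then have "1 + length ds \<le> k * degree p + divisors_degree (map snd ds)"
    using Cons by (intro add_mono) simp_all
  then show ?case by simp
qed simp

lemma card_scale_vimage:
  assumes V: "subspace V" "finite V" and S: "S \<subseteq> (*s) r ` V"
  shows "card {v \<in> V. r *s v \<in> S} = card S * card {v \<in> V. r *s v = 0}"
proof -
  let ?K = "{v \<in> V. r *s v = 0}"
  have finS: "finite S" using S V(2) finite_surj by blast
  have "card {v \<in> {v \<in> V. r *s v \<in> S}. r *s v = u} = card ?K" if u: "u \<in> S" for u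
  proof -
    obtain v where v: "v \<in> V" "r *s v = u" using S u by blast
    have "{v \<in> {v \<in> V. r *s v \<in> S}. r *s v = u} = (+) v ` ?K"
    proof (intro subset_antisym subsetI)
      fix w assume "w \<in> {v \<in> {v \<in> V. r *s v \<in> S}. r *s v = u}"
      then have "w - v \<in> ?K" using v subspace_diff[OF V(1)] by (simp add: scale_right_diff_distrib)
      then show "w \<in> (+) v ` ?K" by (rule rev_image_eqI) simp
    qed (use u v subspace_add[OF V(1)] in \<open>auto simp: scale_right_distrib\<close>)
    then show ?thesis by (simp add: card_image)
  qed
  then have "(\<Sum>v\<in>{v \<in> V. r *s v \<in> S}. card {u \<in> S. r *s v = u}) = card ?K * card S"
    using V(2) finS by (intro sum_multicount) auto
  moreover have "{u \<in> S. r *s v = u} = {r *s v}" if "r *s v \<in> S" for v using that by auto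
  ultimately show ?thesis by (simp add: mult.commute)
qed

end

locale finite_poly_module = poly_module +
  fixes V :: "'b set"
  assumes subspace_V: "subspace V" and finite_V: "finite V"
begin

lemma power_annihilates_pred:
  assumes v: "v \<in> V" "P ^ i *s v = 0" and i: "card V < i"
  shows "P ^ (i - 1) *s v = 0"
proof (rule ccontr)
  assume nonzero: "P ^ (i - 1) *s v \<noteq> 0"
  have "inj_on (\<lambda>t. P ^ t *s v) {..<i}"
  proof (rule linorder_inj_onI')
    fix s t assume st: "s \<in> {..<i}" "t \<in> {..<i}" "s < t"
    show "P ^ s *s v \<noteq> P ^ t *s v"
    proof
      assume "P ^ s *s v = P ^ t *s v"
      then have "P ^ (i - 1 - s) *s P ^ s *s v = P ^ (i - 1 - s) *s P ^ t *s v" by (simp only:)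
      then have "P ^ (i - 1) *s v = P ^ (i - 1 - s + t) *s v" using st by (simp flip: power_add)
      moreover have "P ^ i dvd P ^ (i - 1 - s + t)" using st by (intro le_imp_power_dvd) auto
      ultimately show False using nonzero dvd_annihilates v(2) by metis
    qed
  qed
  then have "card {..<i} \<le> card V"
    using v subspace_scale[OF subspace_V] by (intro card_inj_on_le[of _ _ V] finite_V) auto
  then show False using i by simp
qed

lemma annihilator_exists:
  assumes "v \<in> V"
  obtains f where "f \<noteq> 0" "f *s v = 0"
proof -
  have "range (\<lambda>n. monom 1 n *s v) \<subseteq> V" using assms subspace_scale[OF subspace_V] by blast
  then have "\<not> inj (\<lambda>n. monom 1 n *s v)"
    using finite_V finite_subset finite_imageD infinite_UNIV_nat by blast
  then obtain i j :: nat where ij: "i \<noteq> j" "monom 1 i *s v = monom 1 j *s v"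
    unfolding inj_def by blast
  have "monom 1 i - monom (1::'a) j \<noteq> 0" using ij(1) by (simp add: monom_eq_iff')
  moreover have "(monom 1 i - monom 1 j) *s v = 0"
    using ij(2) by (simp add: scale_left_diff_distrib)
  ultimately show ?thesis using that by blast
qed

lemma subset_if_primary_subset:
  assumes N: "subspace N"
    and primary: "\<And>P i v. monic_irred P \<Longrightarrow> v \<in> V \<Longrightarrow> P ^ i *s v = 0 \<Longrightarrow> v \<in> N"
  shows "V \<subseteq> N"
proof
  fix v assume v: "v \<in> V"
  then obtain f where "f \<noteq> 0" "f *s v = 0" using annihilator_exists by blast
  then show "v \<in> N" using v
  proof (induction "degree f" arbitrary: f v rule: less_induct)
    case less
    show ?case
    proof (cases "degree f = 0")
      case True
      then have "f dvd 1" using less.prems(1) is_unit_iff_degree by blast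
      then have "v = 0" using dvd_annihilates[OF _ less.prems(2)] scale_one by metis
      then show ?thesis using subspace_0[OF N] by simp
    next
      case False
      then obtain p where p: "monic_irred p" "p dvd f" using monic_irred_divisor_exists by blast
      note pos = monic_irred_degree_pos[OF p(1)]
      obtain i g where f: "f = p ^ i * g" "\<not> p dvd g"
        using poly_split_off_power[OF pos less.prems(1)] .
      have "i \<noteq> 0" "g \<noteq> 0" using f p(2) less.prems(1) by (cases i; auto)+
      then have "degree g < degree f"
        using pos monic_irred_nonzero[OF p(1)] by (simp add: f(1) degree_mult_eq degree_power_eq)
      then have "p ^ i *s v \<in> N"
        using \<open>g \<noteq> 0\<close> less.prems subspace_scale[OF subspace_V]
        by (intro less.hyps[of g]) (auto simp: f(1) mult.commute)
      moreover have "g *s v \<in> N"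
        using less.prems subspace_scale[OF subspace_V]
        by (intro primary[OF p(1), of _ i]) (auto simp: f(1))
      moreover obtain s t where "s * p ^ i + t * g = 1"
        using bezout_prime_power[OF monic_irred_prime_elem[OF p(1)] f(2)] .
      then have "v = s *s p ^ i *s v + t *s g *s v" by (simp flip: scale_left_distrib)
      ultimately show ?thesis using subspace_add[OF N] subspace_scale[OF N] by metis
    qed
  qed
qed

lemma direct_family_length_less:
  assumes ds: "direct_family ds" "fst ` set ds \<subseteq> V"
  shows "length ds < card V"
proof -
  have "length ds < 2 ^ length ds" by simp
  also have "(2::nat) ^ length ds \<le> 2 ^ divisors_degree (map snd ds)"
    using length_le_divisors_degree[OF direct_imp_primary_family[OF ds(1)]]
    by (simp add: power_increasing)
  also have "\<dots> \<le> CARD('a) ^ divisors_degree (map snd ds)"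
    using two_le_card_field[where 'a='a] by (simp add: power_mono)
  also have "\<dots> = card (family_span ds)" using ds(1) by (simp add: card_direct_family_span)
  also have "\<dots> \<le> card V"
    using family_span_subset[OF subspace_V ds(2)] by (rule card_mono[OF finite_V])
  finally show ?thesis .
qed

text \<open>The invariant of the greedy construction, which runs from the largest exponent downwards:
  modulo the span, every primary vector has exponent below \<open>j\<close>.\<close>

definition saturated :: "nat \<Rightarrow> ('b \<times> 'a poly \<times> nat) list \<Rightarrow> bool" where
  "saturated j ds \<longleftrightarrow> (\<forall>P i v. monic_irred P \<longrightarrow> j \<le> i \<longrightarrow> v \<in> V \<longrightarrow> P ^ i *s v = 0 \<longrightarrow>
    (\<exists>w\<in>family_span ds. P ^ (i - 1) *s (v - w) = 0))"

lemma direct_family_extend_maximal: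
  assumes "direct_family ds" "fst ` set ds \<subseteq> V" "\<forall>(v, p, k)\<in>set ds. j \<le> k"
  obtains es where "direct_family es" "fst ` set es \<subseteq> V" "\<forall>(v, p, k)\<in>set es. j \<le> k"
    "family_span ds \<subseteq> family_span es"
    "\<And>P v. monic_irred P \<Longrightarrow> 1 \<le> j \<Longrightarrow> v \<in> V \<Longrightarrow> P ^ j *s v = 0 \<Longrightarrow> P ^ (j - 1) *s v \<in> family_span es"
proof -
  define X where "X es \<longleftrightarrow> direct_family es \<and> fst ` set es \<subseteq> V \<and> (\<forall>(v, p, k)\<in>set es. j \<le> k) \<and>
    family_span ds \<subseteq> family_span es" for es
  have "X ds" using assms by (simp add: X_def)
  moreover have "\<forall>es. X es \<longrightarrow> length es < card V" by (simp add: X_def direct_family_length_less)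
  ultimately obtain es where es: "X es" and maximal: "\<And>es'. X es' \<Longrightarrow> length es' \<le> length es"
    using ex_has_greatest_nat[of X ds length "card V"] by blast
  have "P ^ (j - 1) *s v \<in> family_span es"
    if v: "monic_irred P" "1 \<le> j" "v \<in> V" "P ^ j *s v = 0" for P v
  proof (rule ccontr)
    assume "P ^ (j - 1) *s v \<notin> family_span es"
    then have "X ((v, P, j) # es)"
      using es v family_span_Cons_mono[of es "(v, P, j)"] by (auto simp: X_def)
    then show False using maximal by fastforce
  qed
  then show ?thesis using es that unfolding X_def by blast
qed

lemma saturated_family_exists:
  assumes "1 \<le> j" "j \<le> Suc (card V)"
  shows "\<exists>ds. direct_family ds \<and> fst ` set ds \<subseteq> V \<and> (\<forall>(v, p, k)\<in>set ds. j \<le> k) \<and> saturated j ds"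
  using assms(2,1)
proof (induction j rule: inc_induct)
  case base
  show ?case using power_annihilates_pred by (intro exI[of _ "[]"]) (auto simp: saturated_def)
next
  case (step j)
  then obtain ds where ds: "direct_family ds" "fst ` set ds \<subseteq> V" "\<forall>(v, p, k)\<in>set ds. Suc j \<le> k"
    "saturated (Suc j) ds"
    by auto
  then have "\<forall>(v, p, k)\<in>set ds. j \<le> k" by fastforce
  then obtain es where es: "direct_family es" "fst ` set es \<subseteq> V" "\<forall>(v, p, k)\<in>set es. j \<le> k"
    and mono: "family_span ds \<subseteq> family_span es"
    and maximal: "\<And>P v. monic_irred P \<Longrightarrow> 1 \<le> j \<Longrightarrow> v \<in> V \<Longrightarrow> P ^ j *s v = 0 \<Longrightarrow>
      P ^ (j - 1) *s v \<in> family_span es"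
    by (rule direct_family_extend_maximal[OF ds(1,2)]) blast
  have "\<exists>w\<in>family_span es. P ^ (i - 1) *s (v - w) = 0"
    if P: "monic_irred P" and i: "j \<le> i" and v: "v \<in> V" "P ^ i *s v = 0" for P i v
  proof (cases "i = j")
    case False
    then show ?thesis using ds(4) P i v mono unfolding saturated_def
      by (metis Suc_leI le_neq_implies_less subsetD)
  next
    case True
    have "P *s P ^ (j - 1) *s v = 0"
      using v(2) step.prems True by (simp flip: power_Suc)
    then obtain w where w: "w \<in> family_span es" "P ^ (j - 1) *s w = P ^ (j - 1) *s v"
      using direct_family_divide[OF es(1) P step.prems, of "P ^ (j - 1) *s v"] es(3)
        maximal[OF P step.prems v(1)] v(2) True
      by fastforce
    then show ?thesis using True by (intro bexI[of _ w]) (simp_all add: scale_right_diff_distrib)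
  qed
  then have "saturated j es" by (simp add: saturated_def)
  then show ?case using es by blast
qed

theorem direct_family_exists:
  obtains ds where "direct_family ds" "fst ` set ds \<subseteq> V" "family_span ds = V"
proof -
  obtain ds where ds: "direct_family ds" "fst ` set ds \<subseteq> V" and sat: "saturated 1 ds"
    using saturated_family_exists[of 1] by auto
  have sub: "family_span ds \<subseteq> V" using family_span_subset subspace_V ds(2) by blast
  have "v \<in> family_span ds" if P: "monic_irred P" and "v \<in> V" "P ^ i *s v = 0" for P i v
    using that(2,3)
  proof (induction i arbitrary: v)
    case 0
    then show ?case using subspace_0[OF subspace_family_span] by simp
  next
    case (Suc i)
    then obtain w where w: "w \<in> family_span ds" "P ^ i *s (v - w) = 0"
      using sat P unfolding saturated_def by (metis One_nat_def Suc_le_mono diff_Suc_1 le0)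
    then have "v - w \<in> family_span ds" using Suc sub subspace_diff[OF subspace_V] by auto
    then show ?case using w(1) subspace_add[OF subspace_family_span, of "v - w" ds w] by simp
  qed
  then have "V \<subseteq> family_span ds" using subset_if_primary_subset[OF subspace_family_span] by blast
  then show ?thesis using that ds sub by blast
qed

end

section \<open>Counting families\<close>

text \<open>Here \<open>K p k\<close> stands for the number of vectors killed by \<open>p\<^bsup>k\<^esup>\<close>. The exponents in \<open>L\<close> are at
  least \<open>k\<close>.\<close>

definition extension_count ::
  "('a::{finite,field} poly \<Rightarrow> nat \<Rightarrow> nat) \<Rightarrow> ('a poly \<times> nat) list \<Rightarrow> 'a poly \<times> nat \<Rightarrow> real" where
  "extension_count K L = (\<lambda>(p, k). real (K p k) -
    real (K p (k - 1)) * real CARD('a) ^ (degree p * size (divisor_partition L p)))"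

definition family_count ::
  "('a::{finite,field} poly \<Rightarrow> nat \<Rightarrow> nat) \<Rightarrow> ('a poly \<times> nat) list \<Rightarrow> real" where
  "family_count K L = (\<Prod>i<length L. extension_count K (drop (Suc i) L) (L ! i))"

lemma family_count_Nil [simp]: "family_count K [] = 1"
  and family_count_Cons [simp]: "family_count K (d # L) = extension_count K L d * family_count K L"
  by (simp_all add: family_count_def prod.lessThan_Suc_shift del: prod.lessThan_Suc)

context finite_poly_module
begin

definition card_kernel :: "'a poly \<Rightarrow> nat \<Rightarrow> nat" where
  "card_kernel p j = card {v \<in> V. p ^ j *s v = 0}"

definition families :: "('a poly \<times> nat) list \<Rightarrow> ('b \<times> 'a poly \<times> nat) list set" where
  "families L = {ds. map snd ds = L \<and> fst ` set ds \<subseteq> V \<and> direct_family ds}"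

lemma card_extensions:
  assumes ds: "ds \<in> families L" and p: "monic_irred p"
    and k: "1 \<le> k" "\<And>k'. (p, k') \<in> set L \<Longrightarrow> k \<le> k'"
  shows "real (card {v \<in> V. p ^ k *s v = 0 \<and> p ^ (k - 1) *s v \<notin> family_span ds})
    = extension_count card_kernel L (p, k)"
proof -
  let ?S = "{u \<in> family_span ds. p ^ 1 *s u = 0}"
  let ?A = "{v \<in> V. p ^ k *s v = 0}" and ?B = "{v \<in> V. p ^ (k - 1) *s v \<in> ?S}"
  have L: "map snd ds = L" and in_V: "fst ` set ds \<subseteq> V" and direct: "direct_family ds"
    using ds by (simp_all add: families_def)
  have exponents: "k \<le> k'" if "(v, p, k') \<in> set ds" for v k'
    using k(2)[of k'] that unfolding L[symmetric] by force
  have pk: "p ^ k *s v = p *s p ^ (k - 1) *s v" for v using k(1) by (cases k) auto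
  have span_V: "family_span ds \<subseteq> V" using family_span_subset[OF subspace_V in_V] .
  have "?S \<subseteq> (*s) (p ^ (k - 1)) ` V"
    using direct_family_divide[OF direct p k(1) exponents] span_V by (force simp: image_iff)
  then have "card ?B = card ?S * card_kernel p (k - 1)"
    unfolding card_kernel_def by (rule card_scale_vimage[OF subspace_V finite_V])
  also have "card ?S = CARD('a) ^ (degree p * part_conj (divisor_partition L p) 1)"
    using card_direct_family_kernel[OF direct p, of 1] L by simp
  also have "part_conj (divisor_partition L p) 1 = size (divisor_partition L p)"
    using k by (intro part_conj_eq_size_if_ge) (force simp: in_divisor_partition_iff)
  finally have card_B: "card ?B
      = CARD('a) ^ (degree p * size (divisor_partition L p)) * card_kernel p (k - 1)" .
  have "{v \<in> V. p ^ k *s v = 0 \<and> p ^ (k - 1) *s v \<notin> family_span ds} = ?A - ?B" "?B \<subseteq> ?A"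
    unfolding pk by auto
  moreover have "finite ?A" using finite_V by simp
  ultimately have "real (card {v \<in> V. p ^ k *s v = 0 \<and> p ^ (k - 1) *s v \<notin> family_span ds})
      = real (card ?A) - real (card ?B)"
    by (simp add: card_Diff_subset finite_subset card_mono of_nat_diff)
  also have "\<dots> = extension_count card_kernel L (p, k)"
    unfolding card_B extension_count_def by (simp add: card_kernel_def)
  finally show ?thesis .
qed

lemma families_Cons:
  assumes "monic_irred p" "1 \<le> k"
  shows "families ((p, k) # L) = (\<lambda>(ds, v). (v, p, k) # ds) `
    (SIGMA ds:families L. {v \<in> V. p ^ k *s v = 0 \<and> p ^ (k - 1) *s v \<notin> family_span ds})"
    (is "_ = ?f ` ?S")
proof (intro subset_antisym subsetI)
  fix es assume es: "es \<in> families ((p, k) # L)"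
  then obtain v ds where "es = (v, p, k) # ds" by (cases es) (auto simp: families_def)
  then show "es \<in> ?f ` ?S"
    using es by (intro image_eqI[of _ _ "(ds, v)"]) (auto simp: families_def)
qed (use assms in \<open>auto simp: families_def image_subset_iff\<close>)

lemma card_families:
  assumes "sorted (map snd L)" "\<forall>(p, k)\<in>set L. monic_irred p \<and> 1 \<le> k"
  shows "finite (families L) \<and> real (card (families L)) = family_count card_kernel L"
  using assms
proof (induction L)
  case Nil
  have "families [] = {[]}" by (auto simp: families_def)
  then show ?case by simp
next
  case (Cons d L)
  obtain p k where d: "d = (p, k)" by (cases d)
  let ?E = "\<lambda>ds. {v \<in> V. p ^ k *s v = 0 \<and> p ^ (k - 1) *s v \<notin> family_span ds}"
  have pk: "monic_irred p" "1 \<le> k" "\<And>k'. (p, k') \<in> set L \<Longrightarrow> k \<le> k'"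
    using Cons.prems by (force simp: d)+
  have fin: "finite (families L)" and card: "real (card (families L)) = family_count card_kernel L"
    using Cons by auto
  have finE: "finite (?E ds)" for ds using finite_V by simp
  have "card (families (d # L)) = card (SIGMA ds:families L. ?E ds)"
    unfolding d families_Cons[OF pk(1,2)] by (rule card_image) (auto simp: inj_on_def)
  also have "\<dots> = (\<Sum>ds\<in>families L. card (?E ds))" using fin finE by simp
  finally have "real (card (families (d # L))) = (\<Sum>ds\<in>families L. real (card (?E ds)))" by simp
  also have "\<dots> = (\<Sum>ds\<in>families L. extension_count card_kernel L (p, k))"
    by (intro sum.cong refl card_extensions pk) auto
  finally show ?case using fin finE card by (simp add: d families_Cons[OF pk(1,2)])
qed

end

definition kernel_size :: "('a::{finite,field} poly \<times> nat) list \<Rightarrow> 'a poly \<Rightarrow> nat \<Rightarrow> nat" where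
  "kernel_size L p j = CARD('a) ^ (degree p * column_sum (divisor_partition L p) j)"

lemma extension_count_kernel_size:
  fixes L :: "('a::{finite,field} poly \<times> nat) list"
  assumes L: "L = L' @ (p, k) # L''" "sorted (map snd L)" and k: "1 \<le> k"
  shows "extension_count (kernel_size L) L'' (p, k) =
    real (kernel_size L p k) * (1 - (1 / real CARD('a) ^ degree p) ^ Suc (count (mset L') (p, k)))"
proof -
  let ?q = "real CARD('a)" and ?c = "count (mset L') (p, k)"
    and ?s = "size (divisor_partition L'' p)"
  obtain j where j: "k = Suc j" using k by (cases k) auto
  have "part_conj (divisor_partition L' p) k = ?c"
    using L by (subst part_conj_eq_count_if_le)
      (force simp: in_divisor_partition_iff sorted_append count_divisor_partition)+
  moreover have "part_conj (divisor_partition L'' p) k = ?s"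
    using L by (intro part_conj_eq_size_if_ge) (force simp: in_divisor_partition_iff sorted_append)
  ultimately have "part_conj (divisor_partition L p) k = Suc ?c + ?s"
    by (simp add: L(1) part_conj_def)
  then have "column_sum (divisor_partition L p) k
      = column_sum (divisor_partition L p) j + ?s + Suc ?c"
    by (simp add: j column_sum_Suc)
  then have "real (kernel_size L p k)
      = real (kernel_size L p (k - 1)) * ?q ^ (degree p * ?s) * (?q ^ degree p) ^ Suc ?c"
    unfolding kernel_size_def by (simp add: j add_mult_distrib2 power_add power_mult)
  moreover have "(?q ^ degree p) ^ Suc ?c \<noteq> 0" by simp
  ultimately show ?thesis
    by (simp add: extension_count_def field_simps power_one_over del: power_Suc)
qed

lemma sum_list_degree_column_sum:
  "(\<Sum>(p, k)\<leftarrow>L. degree p * column_sum (divisor_partition L p) k) =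
    (\<Sum>p\<in>fst ` set L. degree p *
      (\<Sum>i\<in>{1..\<Sum>\<^sub># (divisor_partition L p)}. (part_conj (divisor_partition L p) i)\<^sup>2))"
  using sum_list_by_divisor_partition[of "fst ` set L" L
      "\<lambda>p k. degree p * column_sum (divisor_partition L p) k"]
  by (simp add: sum_mset_column_sum flip: sum_mset_distrib_left)

lemma prod_qpoch_divisors:
  fixes L :: "('a \<times> nat) list" and x :: "'a \<Rightarrow> real"
  assumes "\<forall>(p, k)\<in>set L. 1 \<le> k"
  shows "(\<Prod>i<length L. 1 - x (fst (L ! i)) ^ Suc (count (mset (take i L)) (L ! i))) =
    (\<Prod>p\<in>fst ` set L. \<Prod>i\<in>{1..\<Sum>\<^sub># (divisor_partition L p)}.
      qpoch (x p) (part_mult (divisor_partition L p) i))"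
proof -
  let ?b = "\<lambda>p. \<Sum>\<^sub># (divisor_partition L p)"
  let ?A = "SIGMA p:fst ` set L. {1..?b p}"
  have "k \<le> ?b p" if "(p, k) \<in> set L" for p k
  proof -
    have "k \<in># divisor_partition L p" using that by (simp add: in_divisor_partition_iff)
    then show ?thesis by (auto dest: multi_member_split)
  qed
  then have sub: "set L \<subseteq> ?A" using assms by force
  have "(\<Prod>i<length L. 1 - x (fst (L ! i)) ^ Suc (count (mset (take i L)) (L ! i)))
      = (\<Prod>d\<in>?A. qpoch (x (fst d)) (count (mset L) d))"
    by (rule prod_prefix_count_qpoch[OF _ sub]) simp
  also have "\<dots> = (\<Prod>(p, i)\<in>?A. qpoch (x p) (part_mult (divisor_partition L p) i))"
    by (rule prod.cong) (auto simp: part_mult_def count_divisor_partition)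
  also have "\<dots> = (\<Prod>p\<in>fst ` set L. \<Prod>i\<in>{1..?b p}. qpoch (x p) (part_mult (divisor_partition L p) i))"
    by (subst prod.Sigma) auto
  finally show ?thesis .
qed

lemma prod_list_kernel_size:
  "(\<Prod>(p, k)\<leftarrow>L. real (kernel_size L p k)) = (\<Prod>p\<in>fst ` set L. real CARD('a) ^ (degree p *
    (\<Sum>i\<in>{1..\<Sum>\<^sub># (divisor_partition L p)}. (part_conj (divisor_partition L p) i)\<^sup>2)))"
  for L :: "('a::{finite,field} poly \<times> nat) list"
proof -
  have "(\<Prod>(p, k)\<leftarrow>L'. real (kernel_size L p k))
      = real CARD('a) ^ (\<Sum>(p, k)\<leftarrow>L'. degree p * column_sum (divisor_partition L p) k)" for L'
    by (induction L') (auto simp: kernel_size_def power_add)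
  then show ?thesis by (simp add: sum_list_degree_column_sum power_sum)
qed

lemma family_count_kernel_size:
  fixes L :: "('a::{finite,field} poly \<times> nat) list"
  assumes sorted: "sorted (map snd L)" and L: "\<forall>(p, k)\<in>set L. 1 \<le> k"
  shows "family_count (kernel_size L) L = (\<Prod>(p, k)\<leftarrow>L. real (kernel_size L p k)) *
    (\<Prod>i<length L. 1 - (1 / real CARD('a) ^ degree (fst (L ! i))) ^
      Suc (count (mset (take i L)) (L ! i)))"
proof -
  let ?f = "\<lambda>i. 1 - (1 / real CARD('a) ^ degree (fst (L ! i))) ^
    Suc (count (mset (take i L)) (L ! i))"
  have "extension_count (kernel_size L) (drop (Suc i) L) (L ! i)
      = (case L ! i of (p, k) \<Rightarrow> real (kernel_size L p k)) * ?f i" if i: "i < length L" for i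
  proof -
    obtain p k where d: "L ! i = (p, k)" by (cases "L ! i")
    have "L = take i L @ (p, k) # drop (Suc i) L" using id_take_nth_drop[OF i] d by simp
    moreover have "1 \<le> k" using L nth_mem[OF i] d by auto
    ultimately have "extension_count (kernel_size L) (drop (Suc i) L) (p, k) =
        real (kernel_size L p k) *
        (1 - (1 / real CARD('a) ^ degree p) ^ Suc (count (mset (take i L)) (p, k)))"
      by (intro extension_count_kernel_size sorted)
    then show ?thesis by (simp only: d prod.case fst_conv)
  qed
  then have "family_count (kernel_size L) L
      = (\<Prod>i<length L. (case L ! i of (p, k) \<Rightarrow> real (kernel_size L p k)) * ?f i)"
    unfolding family_count_def by (intro prod.cong) auto
  then show ?thesis by (simp add: prod.distrib prod.list_conv_set_nth atLeast0LessThan)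
qed

theorem family_count_eq_rcf_denom:
  fixes L :: "('a::{finite,field} poly \<times> nat) list"
  assumes sorted: "sorted (map snd L)"
    and L: "\<forall>(p, k)\<in>set L. monic_irred p \<and> p \<noteq> [:0, 1:] \<and> 1 \<le> k"
  shows "family_count (kernel_size L) L = rcf_denom (real CARD('a)) (divisor_partition L)"
proof -
  have exponents: "\<forall>(p, k)\<in>set L. 1 \<le> k" using L by auto
  have support: "fst ` set L = {p. monic_irred p \<and> p \<noteq> [:0, 1:] \<and> divisor_partition L p \<noteq> {#}}"
    using L unfolding divisor_partition_empty_iff by fastforce
  show ?thesis
    unfolding family_count_kernel_size[OF sorted exponents] prod_list_kernel_size
      prod_qpoch_divisors[OF exponents, of "\<lambda>p. 1 / real CARD('a) ^ degree p"] support
    by (simp only: rcf_denom_def prod.distrib)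
qed

section \<open>The module of an endomorphism\<close>

locale endomorphism = module_hom scale scale T
  for scale :: "'a::field \<Rightarrow> 'v::ab_group_add \<Rightarrow> 'v" (infixr \<open>*c\<close> 75) and T :: "'v \<Rightarrow> 'v"
begin

definition poly_scale :: "'a poly \<Rightarrow> 'v \<Rightarrow> 'v" where
  "poly_scale p v = (\<Sum>i\<le>degree p. coeff p i *c (T ^^ i) v)"

lemma poly_scale_0 [simp]: "poly_scale 0 v = 0"
  by (simp add: poly_scale_def)

lemma poly_scale_pCons: "poly_scale (pCons a p) v = a *c v + T (poly_scale p v)"
proof (cases "p = 0")
  case True
  then show ?thesis by (simp add: poly_scale_def)
next
  case False
  then have "poly_scale (pCons a p) v = a *c v + (\<Sum>i\<le>degree p. coeff p i *c (T ^^ Suc i) v)"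
    unfolding poly_scale_def by (simp add: sum.atMost_Suc_shift del: sum.atMost_Suc)
  also have "(\<Sum>i\<le>degree p. coeff p i *c (T ^^ Suc i) v) = T (poly_scale p v)"
    by (simp add: poly_scale_def sum scale)
  finally show ?thesis .
qed

lemma poly_scale_const: "poly_scale [:a:] v = a *c v"
  by (simp add: poly_scale_pCons)

lemma poly_scale_linear: "poly_scale [:- a, 1:] v = T v - a *c v"
  by (simp add: poly_scale_pCons m1.scale_minus_left)

lemma poly_scale_add: "poly_scale (p + r) v = poly_scale p v + poly_scale r v"
  by (induction p r rule: poly_induct2) (simp_all add: poly_scale_pCons add m1.scale_left_distrib)

lemma poly_scale_smult: "poly_scale (smult a p) v = a *c poly_scale p v"
  by (induction p) (simp_all add: poly_scale_pCons scale m1.scale_right_distrib)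

lemma poly_scale_mult: "poly_scale (p * r) v = poly_scale p (poly_scale r v)"
  by (induction p) (simp_all add: poly_scale_pCons poly_scale_add poly_scale_smult)

lemma poly_scale_right_distrib: "poly_scale p (v + w) = poly_scale p v + poly_scale p w"
  by (induction p) (simp_all add: poly_scale_pCons add m1.scale_right_distrib algebra_simps)

sublocale poly: Modules.module poly_scale
  by unfold_locales
    (simp_all add: poly_scale_right_distrib poly_scale_add poly_scale_mult poly_scale_const
      flip: pCons_one)

lemma poly_scale_eq_sum_below:
  assumes "p \<in> polys_below n"
  shows "poly_scale p v = (\<Sum>i<n. coeff p i *c (T ^^ i) v)"
proof (cases "p = 0")
  case False
  then have "{..degree p} \<subseteq> {..<n}" using assms by (auto simp: polys_below_def)
  then show ?thesis
    unfolding poly_scale_def by (intro sum.mono_neutral_left) (auto simp: coeff_eq_0)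
qed simp

lemma monic_annihilator_top_power:
  assumes "lead_coeff p = 1" "poly_scale p v = 0"
  shows "(T ^^ degree p) v = - (\<Sum>i<degree p. coeff p i *c (T ^^ i) v)"
proof -
  have "poly_scale p v = (\<Sum>i<degree p. coeff p i *c (T ^^ i) v) + (T ^^ degree p) v"
    using assms(1) by (simp add: poly_scale_def lessThan_Suc_atMost[symmetric])
  then show ?thesis using assms(2) by (simp add: eq_neg_iff_add_eq_0 add.commute)
qed

end

section \<open>Vectors as polynomials\<close>

text \<open>The vectors of length \<open>m\<close> do not form a type. Storing them as polynomials of degree less than
  \<open>m\<close> puts them into one additive group, to which the module theory applies.\<close>

definition poly_of_vec :: "'a::zero vec \<Rightarrow> 'a poly" where
  "poly_of_vec v = Poly (map (($) v) [0..<dim_vec v])"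

definition vec_of_poly :: "nat \<Rightarrow> 'a::zero poly \<Rightarrow> 'a vec" where
  "vec_of_poly m f = vec m (coeff f)"

lemma coeff_poly_of_vec: "coeff (poly_of_vec v) i = (if i < dim_vec v then v $ i else 0)"
  by (simp add: poly_of_vec_def nth_default_def)

lemma vec_of_poly_carrier [simp]: "vec_of_poly m f \<in> carrier_vec m"
  by (simp add: vec_of_poly_def)

lemma poly_of_vec_below: "v \<in> carrier_vec m \<Longrightarrow> poly_of_vec v \<in> polys_below m"
  by (auto simp: coeff_poly_of_vec polys_below_iff_coeff)

lemma poly_of_vec_of_poly: "f \<in> polys_below m \<Longrightarrow> poly_of_vec (vec_of_poly m f) = f"
  by (auto simp: poly_eq_iff coeff_poly_of_vec polys_below_iff_coeff vec_of_poly_def)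

lemma vec_of_poly_of_vec: "v \<in> carrier_vec m \<Longrightarrow> vec_of_poly m (poly_of_vec v) = v"
  by (auto simp: coeff_poly_of_vec vec_of_poly_def)

lemma bij_betw_poly_of_vec: "bij_betw poly_of_vec (carrier_vec m) (polys_below m)"
  by (rule bij_betw_byWitness[where f' = "vec_of_poly m"])
    (auto simp: vec_of_poly_of_vec poly_of_vec_of_poly poly_of_vec_below)

lemma vec_of_poly_image: "vec_of_poly m ` polys_below m = carrier_vec m"
  by (rule bij_betw_imp_surj_on[OF bij_betw_byWitness[where f' = poly_of_vec]])
    (auto simp: vec_of_poly_of_vec poly_of_vec_of_poly poly_of_vec_below)

lemma poly_of_vec_eq_iff:
  "v \<in> carrier_vec m \<Longrightarrow> w \<in> carrier_vec m \<Longrightarrow> poly_of_vec v = poly_of_vec w \<longleftrightarrow> v = w"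
  by (metis vec_of_poly_of_vec)

lemma poly_of_vec_zero [simp]: "poly_of_vec (0\<^sub>v m) = 0"
  by (auto simp: poly_eq_iff coeff_poly_of_vec)

lemma poly_of_vec_add:
  "v \<in> carrier_vec m \<Longrightarrow> w \<in> carrier_vec m \<Longrightarrow> poly_of_vec (v + w) = poly_of_vec v + poly_of_vec w"
  by (auto simp: poly_eq_iff coeff_poly_of_vec)

lemma poly_of_vec_smult: "poly_of_vec (c \<cdot>\<^sub>v v) = smult c (poly_of_vec v)"
  by (auto simp: poly_eq_iff coeff_poly_of_vec)

lemma finite_carrier_vec: "finite (carrier_vec m :: 'a::{finite,zero} vec set)"
  using bij_betw_finite[OF bij_betw_poly_of_vec] finite_polys_below by blast

lemma card_carrier_vec: "card (carrier_vec m :: 'a::{finite,zero} vec set) = CARD('a) ^ m"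
  using bij_betw_same_card[OF bij_betw_poly_of_vec] card_polys_below by metis

lemma carrier_vec_append:
  "carrier_vec (n + k) = (\<lambda>(a, b). a @\<^sub>v b) ` (carrier_vec n \<times> carrier_vec k)"
proof (intro subset_antisym subsetI)
  fix c :: "'a vec" assume "c \<in> carrier_vec (n + k)"
  then show "c \<in> (\<lambda>(a, b). a @\<^sub>v b) ` (carrier_vec n \<times> carrier_vec k)"
    by (intro image_eqI[of _ _ "(vec_first c n, vec_last c k)"]) auto
qed auto

lemma mat_of_cols_append_mult_vec:
  assumes "a \<in> carrier_vec (length vs)" "b \<in> carrier_vec (length ws)"
  shows "mat_of_cols m (vs @ ws) *\<^sub>v (a @\<^sub>v b) = mat_of_cols m vs *\<^sub>v a + mat_of_cols m ws *\<^sub>v b"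
proof (rule eq_vecI)
  fix i assume "i < dim_vec (mat_of_cols m vs *\<^sub>v a + mat_of_cols m ws *\<^sub>v b)"
  then have i: "i < m" by simp
  have "row (mat_of_cols m (vs @ ws)) i = row (mat_of_cols m vs) i @\<^sub>v row (mat_of_cols m ws) i"
    using i by (intro eq_vecI) (auto simp: mat_of_cols_index nth_append)
  moreover have row: "row (mat_of_cols m us) i \<in> carrier_vec (length us)" for us :: "'a vec list"
    by (intro carrier_vecI) simp
  ultimately show "(mat_of_cols m (vs @ ws) *\<^sub>v (a @\<^sub>v b)) $ i
      = (mat_of_cols m vs *\<^sub>v a + mat_of_cols m ws *\<^sub>v b) $ i"
    using i scalar_prod_append[OF row row assms] by simp
qed simp

definition mat_endo :: "nat \<Rightarrow> 'a::field mat \<Rightarrow> 'a poly \<Rightarrow> 'a poly" where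
  "mat_endo m x f = poly_of_vec (x *\<^sub>v vec_of_poly m f)"

definition basis_mat :: "nat \<Rightarrow> 'a::field mat \<Rightarrow> ('a vec \<times> 'a poly \<times> nat) list \<Rightarrow> 'a mat" where
  "basis_mat m x ds = mat_of_cols m (cyc_vectors x ds)"

lemma cyc_vectors_Nil [simp]: "cyc_vectors x [] = []"
  and cyc_vectors_Cons [simp]: "cyc_vectors x ((v, p, k) # ds) =
    map (\<lambda>t. x ^\<^sub>m t *\<^sub>v v) [0..<k * degree p] @ cyc_vectors x ds"
  by (simp_all add: cyc_vectors_def)

definition cyclic_decomps ::
  "nat \<Rightarrow> 'a::field mat \<Rightarrow> ('a poly \<times> nat) list \<Rightarrow> ('a vec \<times> 'a poly \<times> nat) list set" where
  "cyclic_decomps m x L = {ds. cyclic_decomp m x ds \<and> map snd ds = L}"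

lemma length_cyc_vectors: "length (cyc_vectors x ds) = divisors_degree (map snd ds)"
  by (induction ds) auto

lemma set_cyc_vectors:
  "w \<in> set (cyc_vectors x ds) \<longleftrightarrow> (\<exists>(v, p, k)\<in>set ds. \<exists>t<k * degree p. w = x ^\<^sub>m t *\<^sub>v v)"
  by (simp add: cyc_vectors_def) (rule bex_cong[OF refl], auto)

lemma basis_mat_carrier: "divisors_degree (map snd ds) = m \<Longrightarrow> basis_mat m x ds \<in> carrier_mat m m"
  using mat_of_cols_carrier(1)[of m "cyc_vectors x ds"]
  by (simp add: basis_mat_def length_cyc_vectors)

lemma cyclic_decomp_carrier: "cyclic_decomp m x ds \<Longrightarrow> fst ` set ds \<subseteq> carrier_vec m"
  by (auto simp: cyclic_decomp_def)

lemma cyclic_decomp_divisors: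
  "cyclic_decomp m x ds \<Longrightarrow> \<forall>(p, k)\<in>set (map snd ds). monic_irred p \<and> 1 \<le> k"
  by (auto simp: cyclic_decomp_def)

lemma cyclic_decomp_basis_mat: "cyclic_decomp m x ds \<Longrightarrow> basis_mat m x ds \<in> GL m"
  using mat_of_cols_carrier(1)[of m "cyc_vectors x ds"]
  by (simp add: cyclic_decomp_def basis_mat_def GL_def)

locale square_mat =
  fixes m :: nat and x :: "'a::{finite,field} mat"
  assumes x_carrier: "x \<in> carrier_mat m m"
begin

abbreviation T :: "'a poly \<Rightarrow> 'a poly" where
  "T \<equiv> mat_endo m x"

sublocale endomorphism smult T
proof
  show "T (f + g) = T f + T g" for f g
  proof -
    have "vec_of_poly m (f + g) = vec_of_poly m f + vec_of_poly m g"
      by (auto simp: vec_of_poly_def)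
    then show ?thesis
      unfolding mat_endo_def using x_carrier
      by (simp add: mult_add_distrib_mat_vec[of _ m m] poly_of_vec_add[of _ m])
  qed
  show "T (smult c f) = smult c (T f)" for c f
  proof -
    have "vec_of_poly m (smult c f) = c \<cdot>\<^sub>v vec_of_poly m f" by (auto simp: vec_of_poly_def)
    then show ?thesis
      unfolding mat_endo_def using x_carrier by (simp add: mult_mat_vec[of _ m m] poly_of_vec_smult)
  qed
qed (simp_all add: smult_add_right smult_add_left)

lemma pow_carrier: "x ^\<^sub>m t \<in> carrier_mat m m"
  using x_carrier by simp

lemma pow_vec_carrier: "v \<in> carrier_vec m \<Longrightarrow> x ^\<^sub>m t *\<^sub>v v \<in> carrier_vec m"
  using pow_carrier by (rule mult_mat_vec_carrier)

lemma poly_act_carrier: "v \<in> carrier_vec m \<Longrightarrow> poly_act x p v \<in> carrier_vec m"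
  by (simp add: poly_act_def)

lemma T_poly_of_vec: "v \<in> carrier_vec m \<Longrightarrow> T (poly_of_vec v) = poly_of_vec (x *\<^sub>v v)"
  by (simp add: mat_endo_def vec_of_poly_of_vec)

lemma T_power_poly_of_vec:
  "v \<in> carrier_vec m \<Longrightarrow> (T ^^ t) (poly_of_vec v) = poly_of_vec (x ^\<^sub>m t *\<^sub>v v)"
proof (induction t arbitrary: v)
  case 0
  then show ?case using x_carrier by simp
next
  case (Suc t)
  have "(T ^^ Suc t) (poly_of_vec v) = (T ^^ t) (poly_of_vec (x *\<^sub>v v))"
    using Suc.prems by (simp add: funpow_swap1 T_poly_of_vec)
  also have "\<dots> = poly_of_vec (x ^\<^sub>m t *\<^sub>v (x *\<^sub>v v))"
    using Suc x_carrier by (intro Suc.IH) simp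
  also have "x ^\<^sub>m t *\<^sub>v (x *\<^sub>v v) = x ^\<^sub>m Suc t *\<^sub>v v"
    using assoc_mult_mat_vec[OF pow_carrier x_carrier Suc.prems] by simp
  finally show ?case .
qed

lemma pow_Suc_mult_vec:
  assumes v: "v \<in> carrier_vec m"
  shows "x ^\<^sub>m Suc t *\<^sub>v v = x *\<^sub>v (x ^\<^sub>m t *\<^sub>v v)"
proof -
  have "poly_of_vec (x ^\<^sub>m Suc t *\<^sub>v v) = T ((T ^^ t) (poly_of_vec v))"
    using T_power_poly_of_vec[OF v, of "Suc t"] by simp
  also have "\<dots> = poly_of_vec (x *\<^sub>v (x ^\<^sub>m t *\<^sub>v v))"
    by (simp only: T_power_poly_of_vec[OF v] T_poly_of_vec[OF pow_vec_carrier[OF v]])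
  finally show ?thesis
    using poly_of_vec_eq_iff[OF pow_vec_carrier[OF v]
      mult_mat_vec_carrier[OF x_carrier pow_vec_carrier[OF v]]]
    by blast
qed

lemma poly_of_vec_poly_act:
  assumes v: "v \<in> carrier_vec m"
  shows "poly_of_vec (poly_act x p v) = poly_scale p (poly_of_vec v)"
proof (rule poly_eqI)
  fix r
  have "coeff (poly_scale p (poly_of_vec v)) r
      = (\<Sum>i\<le>degree p. coeff p i * coeff (poly_of_vec (x ^\<^sub>m i *\<^sub>v v)) r)"
    unfolding poly_scale_def coeff_sum T_power_poly_of_vec[OF v] by simp
  then show "coeff (poly_of_vec (poly_act x p v)) r = coeff (poly_scale p (poly_of_vec v)) r"
    using v x_carrier pow_carrier by (auto simp: poly_act_def coeff_poly_of_vec)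
qed

lemma poly_act_eq_0_iff:
  "v \<in> carrier_vec m \<Longrightarrow> poly_act x p v = 0\<^sub>v m \<longleftrightarrow> poly_scale p (poly_of_vec v) = 0"
  using poly_of_vec_eq_iff[OF poly_act_carrier zero_carrier_vec] by (simp add: poly_of_vec_poly_act)

sublocale finite_poly_module poly_scale "polys_below m"
proof
  show "finite (polys_below m :: 'a poly set)" by (rule finite_polys_below)
  show "poly.subspace (polys_below m)"
  proof (rule poly.subspaceI)
    show "poly_scale p f \<in> polys_below m" if "f \<in> polys_below m" for p f
      using poly_of_vec_poly_act[of "vec_of_poly m f" p] that
        poly_of_vec_below[OF poly_act_carrier[of "vec_of_poly m f" p]]
      by (simp add: poly_of_vec_of_poly)
  qed (simp_all add: polys_below_iff_coeff)
qed

end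

section \<open>Primary cyclic decompositions\<close>

lemma det_nonzero_iff_surj:
  fixes M :: "'a::{finite,field} mat"
  assumes M: "M \<in> carrier_mat m m"
  shows "det M \<noteq> 0 \<longleftrightarrow> (*\<^sub>v) M ` carrier_vec m = carrier_vec m"
proof
  assume "det M \<noteq> 0"
  then obtain N where N: "N \<in> carrier_mat m m" "M * N = 1\<^sub>m m"
    using det_non_zero_imp_unit[OF M, of "()"] by (auto simp: Units_def ring_mat_def)
  have "v = M *\<^sub>v (N *\<^sub>v v)" if "v \<in> carrier_vec m" for v
    using assoc_mult_mat_vec[OF M N(1) that] N(2) that by simp
  then show "(*\<^sub>v) M ` carrier_vec m = carrier_vec m" using M N(1) by (force simp: image_iff)
next
  assume "(*\<^sub>v) M ` carrier_vec m = carrier_vec m"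
  then have inj: "inj_on ((*\<^sub>v) M) (carrier_vec m)"
    by (intro eq_card_imp_inj_on finite_carrier_vec) simp
  have "M *\<^sub>v 0\<^sub>v m = 0\<^sub>v m" using M by auto
  then have "v = 0\<^sub>v m" if "v \<in> carrier_vec m" "M *\<^sub>v v = 0\<^sub>v m" for v
    using inj_onD[OF inj, of v "0\<^sub>v m"] that by simp
  then show "det M \<noteq> 0" using det_0_iff_vec_prod_zero_field[OF M] by blast
qed

context square_mat
begin

abbreviation poly_family :: "('a vec \<times> 'a poly \<times> nat) list \<Rightarrow> ('a poly \<times> 'a poly \<times> nat) list" where
  "poly_family \<equiv> map (apfst poly_of_vec)"

lemma map_snd_poly_family: "map snd (poly_family ds) = map snd ds"
  by (simp add: comp_def)

lemma cyc_vectors_carrier: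
  "fst ` set ds \<subseteq> carrier_vec m \<Longrightarrow> set (cyc_vectors x ds) \<subseteq> carrier_vec m"
  by (induction ds) (auto simp: pow_vec_carrier)

lemma primary_poly_family_iff:
  assumes "fst ` set ds \<subseteq> carrier_vec m"
  shows "primary_family (poly_family ds) \<longleftrightarrow>
    (\<forall>(v, p, k)\<in>set ds. monic_irred p \<and> 1 \<le> k \<and> poly_act x (p ^ k) v = 0\<^sub>v m)"
  using assms by (induction ds) (auto simp: poly_act_eq_0_iff)

lemma poly_scale_mult_vec:
  assumes v: "v \<in> carrier_vec m" and f: "f \<in> polys_below d"
  shows "poly_of_vec (mat_of_cols m (map (\<lambda>t. x ^\<^sub>m t *\<^sub>v v) [0..<d]) *\<^sub>v vec_of_poly d f)
    = poly_scale f (poly_of_vec v)"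
proof (rule poly_eqI)
  fix r
  have "coeff (poly_of_vec (x ^\<^sub>m i *\<^sub>v v)) r = (if r < m then (x ^\<^sub>m i *\<^sub>v v) $ r else 0)" for i
    using carrier_vecD[OF pow_vec_carrier[OF v]] by (simp add: coeff_poly_of_vec)
  then have "coeff (poly_scale f (poly_of_vec v)) r
      = (\<Sum>i<d. coeff f i * (if r < m then (x ^\<^sub>m i *\<^sub>v v) $ r else 0))"
    unfolding poly_scale_eq_sum_below[OF f] coeff_sum T_power_poly_of_vec[OF v] by simp
  then show "coeff (poly_of_vec
        (mat_of_cols m (map (\<lambda>t. x ^\<^sub>m t *\<^sub>v v) [0..<d]) *\<^sub>v vec_of_poly d f)) r
      = coeff (poly_scale f (poly_of_vec v)) r"
    by (auto simp: coeff_poly_of_vec vec_of_poly_def scalar_prod_def mat_of_cols_index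
        lessThan_atLeast0 mult.commute intro!: sum.cong)
qed

lemma basis_mat_Cons_mult_vec:
  assumes v: "v \<in> carrier_vec m" and f: "f \<in> polys_below (k * degree p)"
    and b: "b \<in> carrier_vec (divisors_degree (map snd ds))"
  shows "poly_of_vec (basis_mat m x ((v, p, k) # ds) *\<^sub>v (vec_of_poly (k * degree p) f @\<^sub>v b))
    = poly_scale f (poly_of_vec v) + poly_of_vec (basis_mat m x ds *\<^sub>v b)"
proof -
  let ?A = "mat_of_cols m (map (\<lambda>t. x ^\<^sub>m t *\<^sub>v v) [0..<k * degree p])"
  have "basis_mat m x ((v, p, k) # ds) *\<^sub>v (vec_of_poly (k * degree p) f @\<^sub>v b)
      = ?A *\<^sub>v vec_of_poly (k * degree p) f + basis_mat m x ds *\<^sub>v b"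
    unfolding basis_mat_def cyc_vectors_Cons
    using b by (intro mat_of_cols_append_mult_vec) (simp_all add: length_cyc_vectors)
  moreover have "?A *\<^sub>v vec_of_poly (k * degree p) f \<in> carrier_vec m"
    "basis_mat m x ds *\<^sub>v b \<in> carrier_vec m"
    by (simp_all add: basis_mat_def carrier_vecI)
  ultimately show ?thesis by (simp add: poly_of_vec_add poly_scale_mult_vec[OF v f])
qed

lemma basis_mat_range:
  assumes "fst ` set ds \<subseteq> carrier_vec m" "primary_family (poly_family ds)"
  shows "(\<lambda>c. poly_of_vec (basis_mat m x ds *\<^sub>v c)) ` carrier_vec (divisors_degree (map snd ds))
    = family_span (poly_family ds)"
  using assms
proof (induction ds)
  case Nil
  have "poly_of_vec (basis_mat m x [] *\<^sub>v c) = 0" if "c \<in> carrier_vec 0" for c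
    using that by (auto simp: poly_eq_iff coeff_poly_of_vec basis_mat_def scalar_prod_def)
  then show ?case by (auto intro: rev_image_eqI[OF zero_carrier_vec])
next
  case (Cons d ds)
  obtain v p k where d: "d = (v, p, k)" by (cases d)
  let ?n = "k * degree p" and ?r = "divisors_degree (map snd ds)"
  have v: "v \<in> carrier_vec m" using Cons.prems(1) by (simp add: d)
  have p: "monic_irred p" "poly_scale (p ^ k) (poly_of_vec v) = 0"
    using Cons.prems(2) by (simp_all add: d)
  have "(carrier_vec (divisors_degree (map snd (d # ds))) :: 'a vec set)
      = (\<lambda>(f, b). vec_of_poly ?n f @\<^sub>v b) ` (polys_below ?n \<times> carrier_vec ?r)"
    by (auto simp: d carrier_vec_append image_iff simp flip: vec_of_poly_image[of ?n])
  then have "(\<lambda>c. poly_of_vec (basis_mat m x (d # ds) *\<^sub>v c)) `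
        carrier_vec (divisors_degree (map snd (d # ds)))
      = (\<lambda>(f, b). poly_of_vec (basis_mat m x (d # ds) *\<^sub>v (vec_of_poly ?n f @\<^sub>v b))) `
          (polys_below ?n \<times> carrier_vec ?r)"
    by (simp only: image_image case_prod_unfold)
  also have "\<dots> = (\<lambda>(f, b). poly_scale f (poly_of_vec v) + poly_of_vec (basis_mat m x ds *\<^sub>v b)) `
      (polys_below ?n \<times> carrier_vec ?r)"
    by (rule image_cong) (auto simp: d basis_mat_Cons_mult_vec[OF v])
  also have "\<dots> = (\<lambda>(f, w). poly_scale f (poly_of_vec v) + w) `
      (polys_below ?n \<times> (\<lambda>b. poly_of_vec (basis_mat m x ds *\<^sub>v b)) ` carrier_vec ?r)"
    by (auto simp: image_iff)
  also have "\<dots> = family_span (poly_family (d # ds))"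
    using Cons p by (simp add: d family_span_Cons_primary)
  finally show ?case .
qed

lemma cyclic_decomp_iff_primary:
  "cyclic_decomp m x ds \<longleftrightarrow> fst ` set ds \<subseteq> carrier_vec m \<and> primary_family (poly_family ds) \<and>
    divisors_degree (map snd ds) = m \<and> family_span (poly_family ds) = polys_below m"
proof (cases "fst ` set ds \<subseteq> carrier_vec m")
  case True
  have "det (basis_mat m x ds) \<noteq> 0 \<longleftrightarrow> family_span (poly_family ds) = polys_below m"
    if primary: "primary_family (poly_family ds)" and degree: "divisors_degree (map snd ds) = m"
  proof -
    let ?M = "basis_mat m x ds"
    note M = basis_mat_carrier[OF degree, of x]
    have inj: "inj_on poly_of_vec (carrier_vec m :: 'a vec set)"
      using bij_betw_poly_of_vec by (rule bij_betw_imp_inj_on)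
    have sub: "(*\<^sub>v) ?M ` carrier_vec m \<subseteq> carrier_vec m" using M by auto
    have "det ?M \<noteq> 0 \<longleftrightarrow> (*\<^sub>v) ?M ` carrier_vec m = carrier_vec m"
      by (rule det_nonzero_iff_surj[OF M])
    also have "\<dots> \<longleftrightarrow> poly_of_vec ` (*\<^sub>v) ?M ` carrier_vec m = poly_of_vec ` carrier_vec m"
      by (rule inj_on_image_eq_iff[OF inj sub subset_refl, symmetric])
    also have "poly_of_vec ` (*\<^sub>v) ?M ` carrier_vec m = family_span (poly_family ds)"
      using basis_mat_range[OF True primary] by (simp add: degree image_image)
    finally show ?thesis by (simp add: bij_betw_imp_surj_on[OF bij_betw_poly_of_vec])
  qed
  moreover have "cyclic_decomp m x ds \<longleftrightarrow> primary_family (poly_family ds) \<and>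
      divisors_degree (map snd ds) = m \<and> det (basis_mat m x ds) \<noteq> 0"
    unfolding cyclic_decomp_def primary_poly_family_iff[OF True] length_cyc_vectors basis_mat_def
    using True by fastforce
  ultimately show ?thesis using True by blast
qed (auto simp: cyclic_decomp_def)

lemma cyclic_decomp_iff_direct:
  "cyclic_decomp m x ds \<longleftrightarrow> fst ` set ds \<subseteq> carrier_vec m \<and> direct_family (poly_family ds) \<and>
    family_span (poly_family ds) = polys_below m"
proof
  assume ds: "cyclic_decomp m x ds"
  then have "direct_family (poly_family ds)"
    by (intro direct_familyI_card)
      (simp_all add: cyclic_decomp_iff_primary card_polys_below map_snd_poly_family del: map_map)
  then show "fst ` set ds \<subseteq> carrier_vec m \<and> direct_family (poly_family ds) \<and>
      family_span (poly_family ds) = polys_below m"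
    using ds by (simp add: cyclic_decomp_iff_primary)
next
  assume ds: "fst ` set ds \<subseteq> carrier_vec m \<and> direct_family (poly_family ds) \<and>
      family_span (poly_family ds) = polys_below m"
  then have "CARD('a) ^ divisors_degree (map snd ds) = CARD('a) ^ m"
    using card_direct_family_span[of "poly_family ds"]
    by (simp add: card_polys_below map_snd_poly_family del: map_map)
  then have "divisors_degree (map snd ds) = m" using two_le_card_field[where 'a='a] by simp
  then show "cyclic_decomp m x ds"
    using ds direct_imp_primary_family by (simp add: cyclic_decomp_iff_primary)
qed

lemma poly_family_vec_of_poly:
  assumes "fst ` set es \<subseteq> polys_below m"
  shows "poly_family (map (apfst (vec_of_poly m)) es) = es"
  using assms by (induction es) (auto simp: poly_of_vec_of_poly)

lemma cyclic_decomp_of_family: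
  assumes "direct_family es" "fst ` set es \<subseteq> polys_below m" "family_span es = polys_below m"
  shows "cyclic_decomp m x (map (apfst (vec_of_poly m)) es)"
  unfolding cyclic_decomp_iff_direct poly_family_vec_of_poly[OF assms(2)] using assms by auto

lemma cyclic_decomp_exists: "\<exists>ds. cyclic_decomp m x ds"
  using direct_family_exists cyclic_decomp_of_family by metis

lemma cyclic_decomp_card_kernel:
  assumes "cyclic_decomp m x ds" "monic_irred p"
  shows "card_kernel p j = kernel_size (map snd ds) p j"
  using card_direct_family_kernel[of "poly_family ds" p j] assms
  by (simp add: cyclic_decomp_iff_direct card_kernel_def kernel_size_def map_snd_poly_family
      del: map_map)

lemma cyclic_decomp_unique:
  assumes ds: "cyclic_decomp m x ds" and ds': "cyclic_decomp m x ds'"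
  shows "mset (map snd ds) = mset (map snd ds')"
  unfolding mset_eq_iff_divisor_partition_eq
proof
  fix p
  let ?lam = "divisor_partition (map snd ds) p" and ?lam' = "divisor_partition (map snd ds') p"
  note divisors = cyclic_decomp_divisors[OF ds] cyclic_decomp_divisors[OF ds']
  show "?lam = ?lam'"
  proof (cases "monic_irred p")
    case True
    show ?thesis
    proof (rule partition_eqI)
      show "0 \<notin># ?lam" "0 \<notin># ?lam'" using divisors unfolding in_divisor_partition_iff by auto
      fix j
      have "CARD('a) ^ (degree p * column_sum ?lam j) = CARD('a) ^ (degree p * column_sum ?lam' j)"
        using cyclic_decomp_card_kernel[OF ds True, of j]
          cyclic_decomp_card_kernel[OF ds' True, of j]
        by (simp only: kernel_size_def)
      then show "column_sum ?lam j = column_sum ?lam' j"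
        using two_le_card_field[where 'a='a] monic_irred_degree_pos[OF True] by simp
    qed
  next
    case False
    then have "?lam = {#}" "?lam' = {#}"
      unfolding divisor_partition_empty_iff using divisors by auto
    then show ?thesis by simp
  qed
qed

lemma rcf_data_eq:
  assumes "cyclic_decomp m x ds"
  shows "rcf_data m x = divisor_partition (map snd ds)"
proof -
  have "(\<lambda>p. mset (map (\<lambda>(v, p', k). k) (filter (\<lambda>(v, p', k). p' = p) es)))
      = divisor_partition (map snd es)"
    for es :: "('a vec \<times> 'a poly \<times> nat) list"
    by (intro ext, induction es) auto
  then have "rcf_data m x = divisor_partition (map snd (SOME ds. cyclic_decomp m x ds))"
    unfolding rcf_data_def Let_def .
  moreover have "mset (map snd (SOME ds. cyclic_decomp m x ds)) = mset (map snd ds)"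
    using cyclic_decomp_unique[OF someI[of "cyclic_decomp m x"]] assms by blast
  ultimately show ?thesis unfolding mset_eq_iff_divisor_partition_eq by simp
qed

lemma sorted_cyclic_decomp_exists:
  obtains ds where "cyclic_decomp m x ds" "sorted (map snd (map snd ds))"
proof -
  obtain ds where ds: "cyclic_decomp m x ds" using cyclic_decomp_exists by blast
  let ?ds = "sort_key (\<lambda>d. snd (snd d)) ds"
  have "divisors_degree (map snd ?ds) = divisors_degree (map snd ds)"
    by (intro divisors_degree_mset_cong) simp
  then have "cyclic_decomp m x ?ds"
    using ds unfolding cyclic_decomp_iff_primary primary_family_def family_span_def by simp
  moreover have "sorted (map snd (map snd ?ds))" by (simp add: comp_def)
  ultimately show ?thesis using that by blast
qed

lemma card_eigenspace:
  "card {v \<in> carrier_vec m. x *\<^sub>v v = a \<cdot>\<^sub>v v} = CARD('a) ^ part_conj (rcf_data m x [:- a, 1:]) 1"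
proof -
  obtain ds where ds: "cyclic_decomp m x ds" using cyclic_decomp_exists by blast
  let ?F = "{v \<in> carrier_vec m. x *\<^sub>v v = a \<cdot>\<^sub>v v}"
  have "poly_scale ([:- a, 1:] ^ 1) (poly_of_vec v) = 0 \<longleftrightarrow> x *\<^sub>v v = a \<cdot>\<^sub>v v"
    if v: "v \<in> carrier_vec m" for v
    using poly_of_vec_eq_iff[of "x *\<^sub>v v" m "a \<cdot>\<^sub>v v"] v x_carrier
    by (simp add: poly_scale_linear T_poly_of_vec poly_of_vec_smult)
  then have "poly_of_vec ` ?F = {f \<in> polys_below m. poly_scale ([:- a, 1:] ^ 1) f = 0}"
    unfolding bij_betw_imp_surj_on[OF bij_betw_poly_of_vec, symmetric] by auto
  moreover have "inj_on poly_of_vec ?F"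
    using bij_betw_imp_inj_on[OF bij_betw_poly_of_vec] by (rule inj_on_subset) blast
  then have "card (poly_of_vec ` ?F) = card ?F" by (rule card_image)
  ultimately have "card ?F = card_kernel [:- a, 1:] 1" by (simp add: card_kernel_def)
  also have "\<dots> = CARD('a) ^ part_conj (rcf_data m x [:- a, 1:]) 1"
    using cyclic_decomp_card_kernel[OF ds monic_irred_linear, of "- a" 1]
    by (simp add: kernel_size_def rcf_data_eq[OF ds])
  finally show ?thesis .
qed

lemma rcf_data_z_empty:
  assumes "det x \<noteq> 0"
  shows "rcf_data m x [:0, 1:] = {#}"
proof -
  obtain ds where ds: "cyclic_decomp m x ds" using cyclic_decomp_exists by blast
  let ?lam = "rcf_data m x [:0, 1:]"
  have "0 \<cdot>\<^sub>v v = 0\<^sub>v m" if "v \<in> carrier_vec m" for v :: "'a vec"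
    using that by auto
  then have "{v \<in> carrier_vec m. x *\<^sub>v v = 0 \<cdot>\<^sub>v v} = {0\<^sub>v m}"
    using det_0_iff_vec_prod_zero_field[OF x_carrier] assms x_carrier by auto
  then have "CARD('a) ^ part_conj ?lam 1 = CARD('a) ^ 0" using card_eigenspace[of 0] by simp
  then have "part_conj ?lam 1 = 0" using two_le_card_field[where 'a='a] by simp
  moreover have "part_conj ?lam 1 = size ?lam"
    unfolding rcf_data_eq[OF ds] using cyclic_decomp_divisors[OF ds]
    by (intro part_conj_eq_size_if_ge) (auto simp: in_divisor_partition_iff)
  ultimately show ?thesis by simp
qed

lemma bij_betw_cyclic_decomps_families:
  assumes L: "divisors_degree L = m"
  shows "bij_betw poly_family (cyclic_decomps m x L) (families L)"
proof (rule bij_betw_byWitness[where f' = "map (apfst (vec_of_poly m))"])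
  let ?D = "cyclic_decomps m x L"
  have "map (apfst (vec_of_poly m)) (poly_family ds) = ds" if "fst ` set ds \<subseteq> carrier_vec m" for ds
    using that by (induction ds) (auto simp: vec_of_poly_of_vec)
  then show "\<forall>ds\<in>?D. map (apfst (vec_of_poly m)) (poly_family ds) = ds"
    using cyclic_decomp_carrier unfolding cyclic_decomps_def by blast
  show "\<forall>es\<in>families L. poly_family (map (apfst (vec_of_poly m)) es) = es"
    using poly_family_vec_of_poly by (simp add: families_def del: map_map)
  show "poly_family ` ?D \<subseteq> families L"
    using poly_of_vec_below
    by (force simp: cyclic_decomps_def families_def cyclic_decomp_iff_direct)
  have "map (apfst (vec_of_poly m)) es \<in> ?D" if es: "es \<in> families L" for es
  proof -
    have direct: "direct_family es" and below: "fst ` set es \<subseteq> polys_below m" and "map snd es = L"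
      using es by (simp_all add: families_def)
    then have "card (family_span es) = card (polys_below m :: 'a poly set)"
      using L by (simp add: card_direct_family_span card_polys_below)
    then have "family_span es = polys_below m"
      using card_subset_eq[OF finite_polys_below family_span_subset[OF subspace_V below]] by blast
    then show ?thesis
      using cyclic_decomp_of_family[OF direct below] \<open>map snd es = L\<close>
      by (auto simp: cyclic_decomps_def)
  qed
  then show "map (apfst (vec_of_poly m)) ` families L \<subseteq> ?D" by blast
qed

lemma card_cyclic_decomps:
  assumes L: "rcf_data m x = divisor_partition L" "sorted (map snd L)"
  shows "finite (cyclic_decomps m x L)"
    "real (card (cyclic_decomps m x L)) = family_count (kernel_size L) L"
proof -
  obtain ds where ds: "cyclic_decomp m x ds" using cyclic_decomp_exists by blast
  have lam: "divisor_partition (map snd ds) = divisor_partition L"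
    using L(1) rcf_data_eq[OF ds] by simp
  then have mset: "mset (map snd ds) = mset L" by (simp only: mset_eq_iff_divisor_partition_eq)
  have "set L = set (map snd ds)" using mset_eq_setD[OF mset] ..
  then have divisors: "\<forall>(p, k)\<in>set L. monic_irred p \<and> 1 \<le> k"
    using cyclic_decomp_divisors[OF ds] by simp
  have "card_kernel p j = kernel_size L p j" if "monic_irred p" for p j
    using cyclic_decomp_card_kernel[OF ds that] by (simp add: kernel_size_def lam)
  then have "family_count card_kernel L = family_count (kernel_size L) L"
    unfolding family_count_def extension_count_def using divisors nth_mem
    by (intro prod.cong refl) (fastforce split: prod.splits)
  moreover have "divisors_degree L = m"
    using ds divisors_degree_mset_cong[OF mset] by (simp add: cyclic_decomp_iff_primary)
  note bij = bij_betw_cyclic_decomps_families[OF this]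
  ultimately show "finite (cyclic_decomps m x L)"
    "real (card (cyclic_decomps m x L)) = family_count (kernel_size L) L"
    using card_families[OF L(2) divisors] bij_betw_finite[OF bij] bij_betw_same_card[OF bij]
    by simp_all
qed

end

section \<open>The general linear group\<close>

lemma GL_carrier: "h \<in> GL m \<Longrightarrow> h \<in> carrier_mat m m"
  by (simp add: GL_def)

lemma GL_mult: "h \<in> GL m \<Longrightarrow> g \<in> GL m \<Longrightarrow> h * g \<in> GL m"
  unfolding GL_def by (auto simp: det_mult[of _ m])

lemma GL_iff_inverse:
  "h \<in> GL m \<longleftrightarrow> h \<in> carrier_mat m m \<and> (\<exists>g\<in>carrier_mat m m. h * g = 1\<^sub>m m \<and> g * h = 1\<^sub>m m)"
proof
  assume "h \<in> GL m"
  then have h: "h \<in> carrier_mat m m" "det h \<noteq> 0" by (auto simp: GL_def)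
  from det_non_zero_imp_unit[OF this, of "()"]
  show "h \<in> carrier_mat m m \<and> (\<exists>g\<in>carrier_mat m m. h * g = 1\<^sub>m m \<and> g * h = 1\<^sub>m m)"
    using h(1) by (auto simp: Units_def ring_mat_def)
next
  assume "h \<in> carrier_mat m m \<and> (\<exists>g\<in>carrier_mat m m. h * g = 1\<^sub>m m \<and> g * h = 1\<^sub>m m)"
  then obtain g where h: "h \<in> carrier_mat m m" "g \<in> carrier_mat m m" "h * g = 1\<^sub>m m" by blast
  then have "det h * det g = 1" by (simp flip: det_mult)
  then show "h \<in> GL m" using h(1) by (auto simp: GL_def)
qed

lemma GL_obtain_inverse:
  assumes "h \<in> GL m"
  obtains g where "g \<in> GL m" "h * g = 1\<^sub>m m" "g * h = 1\<^sub>m m"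
  using assms unfolding GL_iff_inverse by blast

lemma GL_mult_vec_nonzero:
  assumes h: "h \<in> GL m" and u: "u \<in> carrier_vec m" "u \<noteq> 0\<^sub>v m"
  shows "h *\<^sub>v u \<noteq> 0\<^sub>v m"
  using det_0_iff_vec_prod_zero_field[OF GL_carrier[OF h]] h u by (auto simp: GL_def)

lemma GL_mult_right_cancel:
  assumes g: "g \<in> GL m" and xy: "x \<in> carrier_mat m m" "y \<in> carrier_mat m m" "x * g = y * g"
  shows "x = y"
proof -
  obtain g' where g': "g' \<in> GL m" "g * g' = 1\<^sub>m m" using GL_obtain_inverse[OF g] .
  have "z = (z * g) * g'" if "z \<in> carrier_mat m m" for z
    using assoc_mult_mat[OF that GL_carrier[OF g] GL_carrier[OF g'(1)]] g'(2) that by simp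
  then show ?thesis using xy by metis
qed

lemma GL_mult_left_cancel:
  assumes g: "g \<in> GL m" and xy: "x \<in> carrier_mat m m" "y \<in> carrier_mat m m" "g * x = g * y"
  shows "x = y"
proof -
  obtain g' where g': "g' \<in> GL m" "g' * g = 1\<^sub>m m" using GL_obtain_inverse[OF g] .
  have "z = g' * (g * z)" if "z \<in> carrier_mat m m" for z
    using assoc_mult_mat[OF GL_carrier[OF g'(1)] GL_carrier[OF g] that] g'(2) that by simp
  then show ?thesis using xy by metis
qed

lemma finite_GL: "finite (GL m :: 'a::{finite,field} mat set)"
proof (rule finite_subset)
  show "finite (mat m m ` (({..<m} \<times> {..<m}) \<rightarrow>\<^sub>E (UNIV :: 'a set)))"
    by (intro finite_imageI finite_PiE) auto
  show "GL m \<subseteq> mat m m ` (({..<m} \<times> {..<m}) \<rightarrow>\<^sub>E (UNIV :: 'a set))"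
  proof
    fix h :: "'a mat" assume "h \<in> GL m"
    then have "h = mat m m (restrict (($$) h) ({..<m} \<times> {..<m}))"
      using GL_carrier[of h m] by (intro eq_matI) auto
    then show "h \<in> mat m m ` (({..<m} \<times> {..<m}) \<rightarrow>\<^sub>E (UNIV :: 'a set))" by auto
  qed
qed

lemma GL_maps_unit_vec:
  fixes v :: "'a::field vec"
  assumes v: "v \<in> carrier_vec m" "v \<noteq> 0\<^sub>v m"
  obtains i h where "i < m" "h \<in> GL m" "h *\<^sub>v unit_vec m i = v"
proof -
  obtain i where i: "i < m" "v $ i \<noteq> 0" using v by (auto simp: vec_eq_iff)
  define h where "h = mat m m (\<lambda>(r, j). if j = i then v $ r else if j = r then 1 else 0)"
  have h: "h \<in> carrier_mat m m" by (simp add: h_def)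
  have mult: "(h *\<^sub>v c) $ r = v $ r * c $ i + (if r = i then 0 else c $ r)"
    if c: "c \<in> carrier_vec m" and r: "r < m" for c r
  proof -
    have "(h *\<^sub>v c) $ r = (\<Sum>j<m. (if j = i then v $ r else if j = r then 1 else 0) * c $ j)"
      using c r by (simp add: h_def scalar_prod_def lessThan_atLeast0)
    also have "\<dots> = (\<Sum>j<m. (if j = i then v $ r * c $ i else 0) +
        (if j = r then if r = i then 0 else c $ r else 0))"
      by (rule sum.cong) auto
    finally show ?thesis using i(1) r by (simp add: sum.distrib)
  qed
  have "det h \<noteq> 0"
  proof
    assume "det h = 0"
    then obtain c where c: "c \<in> carrier_vec m" "c \<noteq> 0\<^sub>v m" "h *\<^sub>v c = 0\<^sub>v m"
      using det_0_iff_vec_prod_zero_field[OF h] by blast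
    have kernel: "v $ r * c $ i + (if r = i then 0 else c $ r) = 0" if "r < m" for r
      using mult[OF c(1) that] c(3) that by simp
    then have "c $ i = 0" using kernel[OF i(1)] i(2) by simp
    then have "c $ r = 0" if "r < m" for r using kernel[OF that] by (cases "r = i") auto
    then show False using c(1,2) by (auto simp: vec_eq_iff)
  qed
  then have "h \<in> GL m" using h by (simp add: GL_def)
  moreover have "h *\<^sub>v unit_vec m i = v"
    using h v(1) i(1) by (intro eq_vecI) (auto simp: h_def)
  ultimately show ?thesis using that i(1) by blast
qed

lemma GL_transitive:
  fixes u w :: "'a::field vec"
  assumes u: "u \<in> carrier_vec m" "u \<noteq> 0\<^sub>v m" and w: "w \<in> carrier_vec m" "w \<noteq> 0\<^sub>v m"
  obtains h where "h \<in> GL m" "h *\<^sub>v u = w"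
proof -
  obtain i f where f: "i < m" "f \<in> GL m" "f *\<^sub>v unit_vec m i = u" using GL_maps_unit_vec[OF u] .
  obtain j g where g: "j < m" "g \<in> GL m" "g *\<^sub>v unit_vec m j = w" using GL_maps_unit_vec[OF w] .
  obtain f' where f': "f' \<in> GL m" "f' * f = 1\<^sub>m m" using GL_obtain_inverse[OF f(2)] .
  let ?s = "swaprows_mat m i j :: 'a mat"
  have s: "?s \<in> GL m" using swaprows_mat_inv[OF f(1) g(1)] by (auto simp: GL_iff_inverse)
  have "?s *\<^sub>v unit_vec m i = unit_vec m j"
    using f(1) g(1) by (intro eq_vecI) (auto simp: scalar_prod_right_unit)
  moreover have "f' *\<^sub>v u = unit_vec m i"
    using assoc_mult_mat_vec[OF GL_carrier[OF f'(1)] GL_carrier[OF f(2)], of "unit_vec m i"]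
      f(3) f'(2)
    by simp
  ultimately have "(g * ?s * f') *\<^sub>v u = w"
    using g(3) u(1) GL_carrier[OF g(2)] GL_carrier[OF s] GL_carrier[OF f'(1)]
      GL_carrier[OF GL_mult[OF g(2) s]]
    by (simp add: assoc_mult_mat_vec[of _ m m _ m])
  then show ?thesis using that GL_mult[OF GL_mult[OF g(2) s] f'(1)] by blast
qed

section \<open>Similar matrices\<close>

lemma mat_of_cols_mult:
  assumes h: "h \<in> carrier_mat m m" and vs: "set vs \<subseteq> carrier_vec m"
  shows "mat_of_cols m (map ((*\<^sub>v) h) vs) = h * mat_of_cols m vs"
proof (rule eq_matI)
  fix i j assume "i < dim_row (h * mat_of_cols m vs)" "j < dim_col (h * mat_of_cols m vs)"
  then have ij: "i < m" "j < length vs" using h by auto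
  moreover have "vs ! j \<in> carrier_vec m" using ij(2) vs by auto
  ultimately show "mat_of_cols m (map ((*\<^sub>v) h) vs) $$ (i, j) = (h * mat_of_cols m vs) $$ (i, j)"
    using h by (simp add: mat_of_cols_index)
qed (use h in auto)

lemma similar_mat_wit_conj:
  assumes "h \<in> GL m" "g \<in> GL m" "h * g = 1\<^sub>m m" "g * h = 1\<^sub>m m" "x \<in> carrier_mat m m"
  shows "similar_mat_wit (h * x * g) x h g"
  using assms by (intro similar_mat_witI[of _ _ m])
    (auto intro!: mult_carrier_mat dest!: GL_carrier)

context
  fixes m :: nat and x y P Q :: "'a::{finite,field} mat"
  assumes wit: "similar_mat_wit y x P Q" and y: "y \<in> carrier_mat m m"
begin

lemmas similarityD = similar_mat_witD2[OF y wit]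

lemma similar_pow_mult_vec:
  assumes v: "v \<in> carrier_vec m"
  shows "y ^\<^sub>m t *\<^sub>v (P *\<^sub>v v) = P *\<^sub>v (x ^\<^sub>m t *\<^sub>v v)"
proof -
  have pow: "x ^\<^sub>m t \<in> carrier_mat m m" using similarityD(5) by simp
  have "Q *\<^sub>v (P *\<^sub>v v) = v"
    using assoc_mult_mat_vec[OF similarityD(7,6) v] similarityD(2) v by simp
  then show ?thesis
    unfolding similar_mat_wit_pow_id[OF wit] using pow similarityD(6,7) v
    by (simp add: assoc_mult_mat_vec[of _ m m _ m])
qed

lemma similar_eigenvector:
  assumes u: "u \<in> carrier_vec m" and eigen: "x *\<^sub>v u = a \<cdot>\<^sub>v u"
  shows "y *\<^sub>v (P *\<^sub>v u) = a \<cdot>\<^sub>v (P *\<^sub>v u)"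
  using similar_pow_mult_vec[OF u, of 1] mult_mat_vec[OF similarityD(6) u, of a] y similarityD(5)
  by (simp add: eigen)

lemma similar_poly_act:
  assumes v: "v \<in> carrier_vec m"
  shows "poly_act y p (P *\<^sub>v v) = P *\<^sub>v poly_act x p v"
proof (rule eq_vecI)
  fix r assume "r < dim_vec (P *\<^sub>v poly_act x p v)"
  then have r: "r < m" using similarityD(6) by simp
  have mult: "(P *\<^sub>v w) $ r = (\<Sum>s<m. P $$ (r, s) * w $ s)" if "dim_vec w = m" for w
    using r that similarityD(6) by (auto simp: scalar_prod_def lessThan_atLeast0 intro!: sum.cong)
  have dim: "dim_vec (x ^\<^sub>m i *\<^sub>v v) = m" for i using similarityD(5) by simp
  have "poly_act y p (P *\<^sub>v v) $ r =
      (\<Sum>i\<le>degree p. coeff p i * (\<Sum>s<m. P $$ (r, s) * (x ^\<^sub>m i *\<^sub>v v) $ s))"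
    using r similarityD(6) by (simp add: poly_act_def similar_pow_mult_vec[OF v] mult[OF dim])
  also have "\<dots> = (\<Sum>s<m. P $$ (r, s) * (\<Sum>i\<le>degree p. coeff p i * (x ^\<^sub>m i *\<^sub>v v) $ s))"
    by (simp add: sum_distrib_left mult.left_commute) (rule sum.swap)
  also have "\<dots> = (P *\<^sub>v poly_act x p v) $ r"
    using v by (simp add: mult poly_act_def)
  finally show "poly_act y p (P *\<^sub>v v) $ r = (P *\<^sub>v poly_act x p v) $ r" .
qed (simp add: poly_act_def)

lemma similar_basis_mat:
  assumes ds: "fst ` set ds \<subseteq> carrier_vec m"
  shows "basis_mat m y (map (apfst ((*\<^sub>v) P)) ds) = P * basis_mat m x ds"
proof -
  have "cyc_vectors y (map (apfst ((*\<^sub>v) P)) ds) = map ((*\<^sub>v) P) (cyc_vectors x ds)"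
    using ds by (induction ds) (auto simp: similar_pow_mult_vec)
  moreover interpret square_mat m x by unfold_locales (rule similarityD(5))
  note mat_of_cols_mult[OF similarityD(6) cyc_vectors_carrier[OF ds]]
  ultimately show ?thesis by (simp add: basis_mat_def)
qed

lemma similar_cyclic_decomp:
  assumes ds: "cyclic_decomp m x ds"
  shows "cyclic_decomp m y (map (apfst ((*\<^sub>v) P)) ds)"
proof -
  note carrier = cyclic_decomp_carrier[OF ds]
  have P: "P \<in> GL m" using similarityD by (auto simp: GL_iff_inverse)
  have "P *\<^sub>v v \<in> carrier_vec m \<and> poly_act y (p ^ k) (P *\<^sub>v v) = 0\<^sub>v m"
    if "(v, p, k) \<in> set ds" for v p k
  proof -
    have v: "v \<in> carrier_vec m" using carrier that by force
    have "poly_act x (p ^ k) v = 0\<^sub>v m" using ds that by (auto simp: cyclic_decomp_def)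
    then have "poly_act y (p ^ k) (P *\<^sub>v v) = 0\<^sub>v m"
      using similar_poly_act[OF v] similarityD(6) by auto
    then show ?thesis using v similarityD(6) by simp
  qed
  moreover have "basis_mat m y (map (apfst ((*\<^sub>v) P)) ds) \<in> GL m"
    unfolding similar_basis_mat[OF carrier] using P cyclic_decomp_basis_mat[OF ds] by (rule GL_mult)
  ultimately show ?thesis
    using ds by (fastforce simp: cyclic_decomp_def basis_mat_def GL_def length_cyc_vectors comp_def)
qed

lemma similar_rcf_data: "rcf_data m y = rcf_data m x"
proof -
  interpret X: square_mat m x by unfold_locales (rule similarityD(5))
  interpret Y: square_mat m y by unfold_locales (rule y)
  obtain ds where ds: "cyclic_decomp m x ds" using X.cyclic_decomp_exists by blast
  show ?thesis
    using X.rcf_data_eq[OF ds] Y.rcf_data_eq[OF similar_cyclic_decomp[OF ds]]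
    by (simp add: comp_def)
qed

end

section \<open>Counting a similarity class\<close>

lemma cyc_vectors_eqD:
  assumes "cyc_vectors x ds = cyc_vectors y ds'" "map snd ds = map snd ds'"
    and "x \<in> carrier_mat m m" "y \<in> carrier_mat m m"
    and "fst ` set ds \<subseteq> carrier_vec m" "fst ` set ds' \<subseteq> carrier_vec m"
    and "\<forall>(v, p, k)\<in>set ds. 0 < k * degree p"
  shows "ds = ds' \<and> (\<forall>(v, p, k)\<in>set ds. \<forall>t<k * degree p. x ^\<^sub>m t *\<^sub>v v = y ^\<^sub>m t *\<^sub>v v)"
  using assms
proof (induction ds arbitrary: ds')
  case (Cons d ds)
  obtain v p k where d: "d = (v, p, k)" by (cases d)
  obtain w es where ds': "ds' = (w, p, k) # es" using Cons.prems(2) by (cases ds') (auto simp: d)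
  have powers: "x ^\<^sub>m t *\<^sub>v v = y ^\<^sub>m t *\<^sub>v w" if "t < k * degree p" for t
    using Cons.prems(1) that by (simp add: d ds')
  have "v = w" using powers[of 0] Cons.prems(3-) by (simp add: d ds')
  moreover have "ds = es \<and> (\<forall>(v, p, k)\<in>set ds. \<forall>t<k * degree p. x ^\<^sub>m t *\<^sub>v v = y ^\<^sub>m t *\<^sub>v v)"
    using Cons.prems by (intro Cons.IH) (simp_all add: d ds')
  ultimately show ?case using powers by (simp add: d ds')
qed simp

lemma annihilated_action_agrees:
  fixes x y :: "'a::{finite,field} mat"
  assumes x: "x \<in> carrier_mat m m" and y: "y \<in> carrier_mat m m" and v: "v \<in> carrier_vec m"
    and f: "lead_coeff f = 1" "poly_act x f v = 0\<^sub>v m" "poly_act y f v = 0\<^sub>v m"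
    and below: "\<And>t. t < degree f \<Longrightarrow> x ^\<^sub>m t *\<^sub>v v = y ^\<^sub>m t *\<^sub>v v"
    and t: "t < degree f"
  shows "x *\<^sub>v (x ^\<^sub>m t *\<^sub>v v) = y *\<^sub>v (x ^\<^sub>m t *\<^sub>v v)"
proof -
  interpret X: square_mat m x by unfold_locales (rule x)
  interpret Y: square_mat m y by unfold_locales (rule y)
  have "poly_of_vec (x ^\<^sub>m degree f *\<^sub>v v)
      = - (\<Sum>i<degree f. smult (coeff f i) (poly_of_vec (x ^\<^sub>m i *\<^sub>v v)))"
    using X.monic_annihilator_top_power[OF f(1), of "poly_of_vec v"] f(2)
    by (simp add: X.poly_act_eq_0_iff[OF v] X.T_power_poly_of_vec[OF v])
  also have "\<dots> = - (\<Sum>i<degree f. smult (coeff f i) (poly_of_vec (y ^\<^sub>m i *\<^sub>v v)))"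
    using below by simp
  also have "\<dots> = poly_of_vec (y ^\<^sub>m degree f *\<^sub>v v)"
    using Y.monic_annihilator_top_power[OF f(1), of "poly_of_vec v"] f(3)
    by (simp add: Y.poly_act_eq_0_iff[OF v] Y.T_power_poly_of_vec[OF v])
  finally have "x ^\<^sub>m degree f *\<^sub>v v = y ^\<^sub>m degree f *\<^sub>v v"
    using poly_of_vec_eq_iff[OF X.pow_vec_carrier[OF v] Y.pow_vec_carrier[OF v]] by simp
  then have "x ^\<^sub>m Suc t *\<^sub>v v = y ^\<^sub>m Suc t *\<^sub>v v" using below t by (metis Suc_lessI)
  then show ?thesis
    using below[OF t] by (simp only: X.pow_Suc_mult_vec[OF v] Y.pow_Suc_mult_vec[OF v])
qed

text \<open>A basis matrix and the elementary divisors determine the action on every basis vector: the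
  last power of each generator is expressed through the lower ones by the elementary divisor.\<close>

lemma basis_mat_inject:
  fixes x y :: "'a::{finite,field} mat"
  assumes ds: "cyclic_decomp m x ds" and ds': "cyclic_decomp m y ds'"
    and xy: "x \<in> carrier_mat m m" "y \<in> carrier_mat m m"
    and divisors: "map snd ds = map snd ds'" and basis: "basis_mat m x ds = basis_mat m y ds'"
  shows "x = y \<and> ds = ds'"
proof -
  interpret X: square_mat m x by unfold_locales (rule xy)
  interpret Y: square_mat m y by unfold_locales (rule xy)
  note carrier = cyclic_decomp_carrier[OF ds] cyclic_decomp_carrier[OF ds']
  have "cyc_vectors x ds = cyc_vectors y ds'"
    using basis cols_mat_of_cols[OF X.cyc_vectors_carrier[OF carrier(1)]]
      cols_mat_of_cols[OF Y.cyc_vectors_carrier[OF carrier(2)]]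
    unfolding basis_mat_def by metis
  moreover have "\<forall>(v, p, k)\<in>set ds. 0 < k * degree p"
    using cyclic_decomp_divisors[OF ds] monic_irred_degree_pos by fastforce
  ultimately have eq: "ds = ds'"
    and powers: "\<forall>(v, p, k)\<in>set ds. \<forall>t<k * degree p. x ^\<^sub>m t *\<^sub>v v = y ^\<^sub>m t *\<^sub>v v"
    using cyc_vectors_eqD[OF _ divisors xy carrier] by blast+
  have "x *\<^sub>v w = y *\<^sub>v w" if "w \<in> set (cyc_vectors x ds)" for w
  proof -
    obtain v p k t where d: "(v, p, k) \<in> set ds" and t: "t < k * degree p" "w = x ^\<^sub>m t *\<^sub>v v"
      using \<open>w \<in> _\<close> unfolding set_cyc_vectors by blast
    have v: "v \<in> carrier_vec m" and p: "monic_irred p"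
      and zero: "poly_act x (p ^ k) v = 0\<^sub>v m" "poly_act y (p ^ k) v = 0\<^sub>v m"
      using ds ds' d by (auto simp: cyclic_decomp_def eq)
    have "lead_coeff (p ^ k) = 1" using p by (simp add: lead_coeff_power monic_irred_def)
    then show ?thesis
      unfolding t(2) using powers d t(1)
      by (intro annihilated_action_agrees[OF xy v _ zero])
        (auto simp: monic_irred_degree_power[OF p])
  qed
  then have "x * basis_mat m x ds = y * basis_mat m x ds"
    using mat_of_cols_mult[OF xy(1) X.cyc_vectors_carrier[OF carrier(1)]]
      mat_of_cols_mult[OF xy(2) X.cyc_vectors_carrier[OF carrier(1)]]
    by (metis basis_mat_def map_cong)
  then show ?thesis using eq GL_mult_right_cancel[OF cyclic_decomp_basis_mat[OF ds] xy] by blast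
qed

lemma basis_mat_surj:
  fixes beta :: "'a::{finite,field} mat"
  assumes beta: "beta \<in> GL m" and ds: "cyclic_decomp m beta ds" and G: "G \<in> GL m"
  obtains x ds' where "x \<in> GL m" "rcf_data m x = rcf_data m beta" "cyclic_decomp m x ds'"
    "map snd ds' = map snd ds" "basis_mat m x ds' = G"
proof -
  obtain B' where B': "B' \<in> GL m" "B' * basis_mat m beta ds = 1\<^sub>m m"
    using GL_obtain_inverse[OF cyclic_decomp_basis_mat[OF ds]] .
  define h where "h = G * B'"
  have h: "h \<in> GL m" unfolding h_def using G B'(1) by (rule GL_mult)
  have hB: "h * basis_mat m beta ds = G"
    unfolding h_def using B'(2) GL_carrier[OF G] GL_carrier[OF B'(1)]
      GL_carrier[OF cyclic_decomp_basis_mat[OF ds]] by (simp add: assoc_mult_mat[of _ m m _ m _ m])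
  obtain g where g: "g \<in> GL m" "h * g = 1\<^sub>m m" "g * h = 1\<^sub>m m" using GL_obtain_inverse[OF h] .
  define x where "x = h * beta * g"
  have x: "x \<in> GL m" unfolding x_def using h beta g(1) by (intro GL_mult)
  have wit: "similar_mat_wit x beta h g"
    unfolding x_def using h g GL_carrier[OF beta] by (rule similar_mat_wit_conj)
  show ?thesis
  proof (rule that[OF x])
    show "rcf_data m x = rcf_data m beta" by (rule similar_rcf_data[OF wit GL_carrier[OF x]])
    show "cyclic_decomp m x (map (apfst ((*\<^sub>v) h)) ds)"
      by (rule similar_cyclic_decomp[OF wit GL_carrier[OF x] ds])
    show "basis_mat m x (map (apfst ((*\<^sub>v) h)) ds) = G"
      using similar_basis_mat[OF wit GL_carrier[OF x] cyclic_decomp_carrier[OF ds]] hB by simp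
  qed (simp add: comp_def)
qed

definition rcf_class :: "nat \<Rightarrow> ('a::field poly \<Rightarrow> nat multiset) \<Rightarrow> 'a mat set" where
  "rcf_class m lam = {x \<in> GL m. rcf_data m x = lam}"

lemma finite_rcf_class: "finite (rcf_class m lam :: 'a::{finite,field} mat set)"
  unfolding rcf_class_def using finite_GL by (rule rev_finite_subset) blast

lemma bij_betw_basis_mat:
  fixes beta :: "'a::{finite,field} mat"
  assumes beta: "beta \<in> GL m" and ds: "cyclic_decomp m beta ds"
  shows "bij_betw (\<lambda>(x, ds'). basis_mat m x ds')
    (SIGMA x:rcf_class m (rcf_data m beta). cyclic_decomps m x (map snd ds)) (GL m)"
    (is "bij_betw _ ?S _")
proof (intro bij_betw_imageI subset_antisym subsetI)
  have "x = y \<and> es = fs" if "(x, es) \<in> ?S" "(y, fs) \<in> ?S" "basis_mat m x es = basis_mat m y fs"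
    for x y es fs
    using that by (intro basis_mat_inject) (auto simp: rcf_class_def cyclic_decomps_def GL_carrier)
  then show "inj_on (\<lambda>(x, ds'). basis_mat m x ds') ?S" unfolding inj_on_def by fast
  fix G :: "'a mat" assume "G \<in> GL m"
  then obtain x ds' where "x \<in> GL m" "rcf_data m x = rcf_data m beta" "cyclic_decomp m x ds'"
    "map snd ds' = map snd ds" "basis_mat m x ds' = G"
    using basis_mat_surj[OF beta ds] by blast
  then show "G \<in> (\<lambda>(x, ds'). basis_mat m x ds') ` ?S"
    by (force simp: rcf_class_def cyclic_decomps_def)
qed (auto simp: cyclic_decomps_def cyclic_decomp_basis_mat)

theorem card_rcf_class:
  fixes beta :: "'a::{finite,field} mat"
  assumes beta: "beta \<in> GL m"
  shows "real (card (rcf_class m (rcf_data m beta))) * rcf_denom (real CARD('a)) (rcf_data m beta)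
    = real (card (GL m :: 'a mat set))"
proof -
  let ?lam = "rcf_data m beta"
  interpret B: square_mat m beta by unfold_locales (rule GL_carrier[OF beta])
  obtain ds where ds: "cyclic_decomp m beta ds" "sorted (map snd (map snd ds))"
    using B.sorted_cyclic_decomp_exists .
  define L where "L = map snd ds"
  have lam: "?lam = divisor_partition L" unfolding L_def by (rule B.rcf_data_eq[OF ds(1)])
  have "[:0, 1:] \<notin> fst ` set L"
    using B.rcf_data_z_empty beta unfolding lam divisor_partition_empty_iff by (simp add: GL_def)
  then have count: "family_count (kernel_size L) L = rcf_denom (real CARD('a)) ?lam"
    unfolding lam using cyclic_decomp_divisors[OF ds(1)] ds(2)
    by (intro family_count_eq_rcf_denom) (force simp: L_def)+
  have decomps: "finite (cyclic_decomps m x L)"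
    "real (card (cyclic_decomps m x L)) = rcf_denom (real CARD('a)) ?lam"
    if "x \<in> rcf_class m ?lam" for x
  proof -
    interpret X: square_mat m x
      by unfold_locales (use that in \<open>simp add: rcf_class_def GL_carrier\<close>)
    have "rcf_data m x = divisor_partition L" using that by (simp add: rcf_class_def lam)
    from X.card_cyclic_decomps[OF this]
    show "finite (cyclic_decomps m x L)"
      "real (card (cyclic_decomps m x L)) = rcf_denom (real CARD('a)) ?lam"
      using ds(2) count by (simp_all add: L_def)
  qed
  have "card (GL m :: 'a mat set) = card (SIGMA x:rcf_class m ?lam. cyclic_decomps m x L)"
    using bij_betw_same_card[OF bij_betw_basis_mat[OF beta ds(1)]] by (simp add: L_def)
  also have "\<dots> = (\<Sum>x\<in>rcf_class m ?lam. card (cyclic_decomps m x L))"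
    using finite_rcf_class decomps(1) by (intro card_SigmaI) auto
  finally show ?thesis using decomps(2) by simp
qed

lemma rcf_denom_nonzero:
  fixes beta :: "'a::{finite,field} mat"
  assumes beta: "beta \<in> GL m"
  shows "rcf_denom (real CARD('a)) (rcf_data m beta) \<noteq> 0"
proof -
  have "card (GL m :: 'a mat set) \<noteq> 0" using finite_GL beta by (auto simp: card_eq_0_iff)
  then show ?thesis using card_rcf_class[OF beta] by auto
qed

section \<open>Counting eigenvectors\<close>

lemma card_nonzero_vec:
  "card (carrier_vec m - {0\<^sub>v m :: 'a::{finite,field} vec}) = CARD('a) ^ m - 1"
  using finite_carrier_vec[where 'a='a, of m] by (simp add: card_carrier_vec)

text \<open>By transitivity all fibres of an equivariant relation over nonzero vectors have equal size.\<close>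

lemma sum_card_equivariant_relation:
  fixes R :: "'b \<Rightarrow> 'a::{finite,field} vec \<Rightarrow> bool"
  assumes X: "finite X"
    and equivariant: "\<And>h. h \<in> GL m \<Longrightarrow> \<exists>F. inj_on F X \<and> F ` X \<subseteq> X \<and>
      (\<forall>x\<in>X. \<forall>u\<in>carrier_vec m. R x u \<longrightarrow> R (F x) (h *\<^sub>v u))"
    and w: "w \<in> carrier_vec m" "w \<noteq> 0\<^sub>v m"
  shows "(\<Sum>x\<in>X. card {u \<in> carrier_vec m - {0\<^sub>v m}. R x u})
      = card {x \<in> X. R x w} * (CARD('a) ^ m - 1)"
proof -
  have fibre_le: "card {x \<in> X. R x u} \<le> card {x \<in> X. R x v}"
    if u: "u \<in> carrier_vec m" "u \<noteq> 0\<^sub>v m" and v: "v \<in> carrier_vec m" "v \<noteq> 0\<^sub>v m" for u v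
  proof -
    obtain h where h: "h \<in> GL m" "h *\<^sub>v u = v" using GL_transitive[OF u v] .
    then obtain F where F: "inj_on F X" "F ` X \<subseteq> X"
      "\<forall>x\<in>X. \<forall>u\<in>carrier_vec m. R x u \<longrightarrow> R (F x) (h *\<^sub>v u)"
      using equivariant by blast
    have "F ` {x \<in> X. R x u} \<subseteq> {x \<in> X. R x v}" using F(2,3) u(1) h(2) by blast
    moreover have "inj_on F {x \<in> X. R x u}" using F(1) by (rule inj_on_subset) blast
    ultimately show ?thesis using X by (intro card_inj_on_le) auto
  qed
  have "card {x \<in> X. R x u} = card {x \<in> X. R x w}" if "u \<in> carrier_vec m - {0\<^sub>v m}" for u
    using fibre_le[OF _ _ w] fibre_le[OF w] that by (simp add: le_antisym)
  then have "(\<Sum>x\<in>X. card {u \<in> carrier_vec m - {0\<^sub>v m}. R x u})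
      = card {x \<in> X. R x w} * card (carrier_vec m - {0\<^sub>v m :: 'a vec})"
    using X finite_carrier_vec by (intro sum_multicount) auto
  then show ?thesis by (simp only: card_nonzero_vec)
qed

lemma card_GL_orbit:
  fixes e w :: "'a::{finite,field} vec"
  assumes e: "e \<in> carrier_vec m" "e \<noteq> 0\<^sub>v m" and w: "w \<in> carrier_vec m" "w \<noteq> 0\<^sub>v m"
  shows "card (GL m :: 'a mat set) = card {x \<in> GL m. x *\<^sub>v e = w} * (CARD('a) ^ m - 1)"
proof -
  have "\<exists>F. inj_on F (GL m) \<and> F ` GL m \<subseteq> GL m \<and>
      (\<forall>x\<in>GL m. \<forall>u\<in>carrier_vec m. x *\<^sub>v e = u \<longrightarrow> F x *\<^sub>v e = h *\<^sub>v u)" if h: "h \<in> GL m" for h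
  proof (intro exI conjI ballI impI)
    show "inj_on ((*) h) (GL m)"
      using GL_mult_left_cancel[OF h] GL_carrier by (blast intro: inj_onI)
    show "(*) h ` GL m \<subseteq> GL m" using GL_mult[OF h] by blast
    show "h * x *\<^sub>v e = h *\<^sub>v u" if "x \<in> GL m" "x *\<^sub>v e = u" for x u
      using assoc_mult_mat_vec[OF GL_carrier[OF h] GL_carrier[OF that(1)] e(1)] that(2) by simp
  qed
  then have "(\<Sum>x\<in>GL m. card {u \<in> carrier_vec m - {0\<^sub>v m}. x *\<^sub>v e = u})
      = card {x \<in> GL m. x *\<^sub>v e = w} * (CARD('a) ^ m - 1)"
    by (intro sum_card_equivariant_relation finite_GL w)
  moreover have "{u \<in> carrier_vec m - {0\<^sub>v m}. x *\<^sub>v e = u} = {x *\<^sub>v e}" if x: "x \<in> GL m" for x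
    using mult_mat_vec_carrier[OF GL_carrier[OF x] e(1)] GL_mult_vec_nonzero[OF x e] by auto
  ultimately show ?thesis by simp
qed

lemma conj_rcf_class:
  fixes h g :: "'a::{finite,field} mat"
  assumes h: "h \<in> GL m" and g: "g \<in> GL m" "h * g = 1\<^sub>m m" "g * h = 1\<^sub>m m"
  shows "inj_on (\<lambda>x. h * x * g) (rcf_class m lam)"
    and "(\<lambda>x. h * x * g) ` rcf_class m lam \<subseteq> rcf_class m lam"
proof -
  show "inj_on (\<lambda>x. h * x * g) (rcf_class m lam)"
  proof (rule inj_onI)
    fix x y assume "x \<in> rcf_class m lam" "y \<in> rcf_class m lam" and eq: "h * x * g = h * y * g"
    then have xy: "x \<in> carrier_mat m m" "y \<in> carrier_mat m m"
      by (auto simp: rcf_class_def GL_carrier)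
    have "h * x = h * y"
      using GL_mult_right_cancel[OF g(1) mult_carrier_mat mult_carrier_mat eq] GL_carrier[OF h] xy
      by blast
    then show "x = y" by (rule GL_mult_left_cancel[OF h xy])
  qed
  have "h * x * g \<in> rcf_class m lam" if "x \<in> rcf_class m lam" for x
  proof -
    have x: "x \<in> GL m" "rcf_data m x = lam" using that by (simp_all add: rcf_class_def)
    have hxg: "h * x * g \<in> GL m" using h x(1) g(1) by (intro GL_mult)
    then show ?thesis
      using similar_rcf_data[OF similar_mat_wit_conj[OF h g GL_carrier[OF x(1)]] GL_carrier[OF hxg]]
        x(2)
      by (simp add: rcf_class_def)
  qed
  then show "(\<lambda>x. h * x * g) ` rcf_class m lam \<subseteq> rcf_class m lam" by blast
qed

lemma card_rcf_class_eigenvector: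
  fixes w :: "'a::{finite,field} vec"
  assumes w: "w \<in> carrier_vec m" "w \<noteq> 0\<^sub>v m"
  shows "card (rcf_class m lam) * (CARD('a) ^ part_conj (lam [:- a, 1:]) 1 - 1)
    = card {x \<in> rcf_class m lam. x *\<^sub>v w = a \<cdot>\<^sub>v w} * (CARD('a) ^ m - 1)"
proof -
  let ?C = "rcf_class m lam"
  have "\<exists>F. inj_on F ?C \<and> F ` ?C \<subseteq> ?C \<and>
      (\<forall>x\<in>?C. \<forall>u\<in>carrier_vec m. x *\<^sub>v u = a \<cdot>\<^sub>v u \<longrightarrow> F x *\<^sub>v (h *\<^sub>v u) = a \<cdot>\<^sub>v (h *\<^sub>v u))"
    if h: "h \<in> GL m" for h
  proof -
    obtain g where g: "g \<in> GL m" "h * g = 1\<^sub>m m" "g * h = 1\<^sub>m m" using GL_obtain_inverse[OF h] .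
    have "h * x * g *\<^sub>v (h *\<^sub>v u) = a \<cdot>\<^sub>v (h *\<^sub>v u)"
      if x: "x \<in> ?C" and u: "u \<in> carrier_vec m" "x *\<^sub>v u = a \<cdot>\<^sub>v u" for x u
    proof (rule similar_eigenvector[OF _ _ u])
      show "similar_mat_wit (h * x * g) x h g"
        using x by (intro similar_mat_wit_conj[OF h g]) (simp add: rcf_class_def GL_carrier)
      show "h * x * g \<in> carrier_mat m m"
        using conj_rcf_class(2)[OF h g, of lam] x by (auto simp: rcf_class_def GL_carrier)
    qed
    then show ?thesis using conj_rcf_class[OF h g] by blast
  qed
  then have "(\<Sum>x\<in>?C. card {u \<in> carrier_vec m - {0\<^sub>v m}. x *\<^sub>v u = a \<cdot>\<^sub>v u})
      = card {x \<in> ?C. x *\<^sub>v w = a \<cdot>\<^sub>v w} * (CARD('a) ^ m - 1)"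
    by (intro sum_card_equivariant_relation finite_rcf_class w)
  moreover have "card {u \<in> carrier_vec m - {0\<^sub>v m}. x *\<^sub>v u = a \<cdot>\<^sub>v u}
      = CARD('a) ^ part_conj (lam [:- a, 1:]) 1 - 1" if "x \<in> ?C" for x
  proof -
    have x: "x \<in> carrier_mat m m" "rcf_data m x = lam"
      using that by (simp_all add: rcf_class_def GL_carrier)
    interpret square_mat m x by unfold_locales (rule x(1))
    have "{u \<in> carrier_vec m - {0\<^sub>v m}. x *\<^sub>v u = a \<cdot>\<^sub>v u}
        = {u \<in> carrier_vec m. x *\<^sub>v u = a \<cdot>\<^sub>v u} - {0\<^sub>v m}" by blast
    moreover have "0\<^sub>v m \<in> {u \<in> carrier_vec m. x *\<^sub>v u = a \<cdot>\<^sub>v u}" using x(1) by auto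
    ultimately show ?thesis
      using card_eigenspace[of a] finite_carrier_vec[where 'a='a, of m] x(2) by simp
  qed
  ultimately show ?thesis by simp
qed

section \<open>The affine and the parabolic group\<close>

definition axis_GL :: "nat \<Rightarrow> 'a::field \<Rightarrow> 'a mat set" where
  "axis_GL m a = {x \<in> GL m. x *\<^sub>v unit_vec m 0 = a \<cdot>\<^sub>v unit_vec m 0}"

lemma finite_axis_GL: "finite (axis_GL m a :: 'a::{finite,field} mat set)"
  unfolding axis_GL_def using finite_GL by (rule rev_finite_subset) blast

lemma axis_GL_iff_first_column:
  "x \<in> axis_GL (n + 1) a \<longleftrightarrow> x \<in> GL (n + 1) \<and> x $$ (0, 0) = a \<and> (\<forall>j\<in>{1..n}. x $$ (j, 0) = 0)"
proof -
  have "x *\<^sub>v unit_vec (n + 1) 0 = a \<cdot>\<^sub>v unit_vec (n + 1) 0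
      \<longleftrightarrow> (\<forall>i<n + 1. x $$ (i, 0) = (if i = 0 then a else 0))" if "x \<in> GL (n + 1)"
    using GL_carrier[OF that] by (auto simp: vec_eq_iff scalar_prod_right_unit)
  also have "\<dots> \<longleftrightarrow> x $$ (0, 0) = a \<and> (\<forall>j\<in>{1..n}. x $$ (j, 0) = 0)"
    by (auto simp: less_Suc_eq_le Suc_le_eq)
  finally show ?thesis by (auto simp: axis_GL_def)
qed

lemma A_grp_eq: "A_grp n = axis_GL (n + 1) 1"
  unfolding A_grp_def set_eq_iff axis_GL_iff_first_column by simp

lemma P_grp_eq: "P_grp n = (\<Union>a\<in>{a. a \<noteq> 0}. axis_GL (n + 1) a)"
  unfolding P_grp_def set_eq_iff UN_iff axis_GL_iff_first_column by auto

lemma axis_GL_disjoint: "a \<noteq> b \<Longrightarrow> axis_GL (n + 1) a \<inter> axis_GL (n + 1) b = {}"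
  unfolding disjoint_iff axis_GL_iff_first_column by auto

lemma card_GL_eq_axis_GL:
  fixes a :: "'a::{finite,field}"
  assumes "a \<noteq> 0" "0 < m"
  shows "card (GL m :: 'a mat set) = card (axis_GL m a) * (CARD('a) ^ m - 1)"
proof -
  have "(a \<cdot>\<^sub>v unit_vec m 0) $ 0 \<noteq> 0\<^sub>v m $ 0" using assms by simp
  then have "a \<cdot>\<^sub>v unit_vec m 0 \<noteq> 0\<^sub>v m" by metis
  then show ?thesis unfolding axis_GL_def using assms(2) by (intro card_GL_orbit) auto
qed

lemma card_axis_GL:
  fixes a b :: "'a::{finite,field}"
  assumes "a \<noteq> 0" "b \<noteq> 0" "0 < m"
  shows "card (axis_GL m a) = card (axis_GL m b)"
proof -
  have "1 < CARD('a) ^ m"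
    using two_le_card_field[where 'a='a] assms(3) by (intro one_less_power) auto
  then show ?thesis
    using card_GL_eq_axis_GL[OF assms(1,3)] card_GL_eq_axis_GL[OF assms(2,3)] by simp
qed

lemma card_axis_GL_rcf_data:
  fixes beta :: "'a::{finite,field} mat"
  assumes beta: "beta \<in> GL m" and m: "0 < m"
  shows "real (card {x \<in> axis_GL m a. rcf_data m x = rcf_data m beta}) =
    real (card (axis_GL m (1::'a))) * (real CARD('a) ^ part_conj (rcf_data m beta [:- a, 1:]) 1 - 1)
      / rcf_denom (real CARD('a)) (rcf_data m beta)"
proof -
  let ?lam = "rcf_data m beta" and ?q = "real CARD('a)"
  let ?N = "card {x \<in> axis_GL m a. rcf_data m x = ?lam}" and ?c = "part_conj (?lam [:- a, 1:]) 1"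
  have "{x \<in> axis_GL m a. rcf_data m x = ?lam}
      = {x \<in> rcf_class m ?lam. x *\<^sub>v unit_vec m 0 = a \<cdot>\<^sub>v unit_vec m 0}"
    by (auto simp: axis_GL_def rcf_class_def)
  then have "card (rcf_class m ?lam) * (CARD('a) ^ ?c - 1) = ?N * (CARD('a) ^ m - 1)"
    using card_rcf_class_eigenvector[of "unit_vec m 0" m ?lam a] m by simp
  then have "real (card (rcf_class m ?lam) * (CARD('a) ^ ?c - 1)) = real (?N * (CARD('a) ^ m - 1))"
    by (rule arg_cong)
  then have eigen: "real (card (rcf_class m ?lam)) * (?q ^ ?c - 1) = real ?N * (?q ^ m - 1)"
    by (simp add: of_nat_diff)
  have GL: "real (card (rcf_class m ?lam)) * rcf_denom ?q ?lam
      = real (card (axis_GL m (1::'a))) * (?q ^ m - 1)"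
    unfolding card_rcf_class[OF beta] card_GL_eq_axis_GL[of "1::'a", OF one_neq_zero m]
    by (simp add: of_nat_diff)
  have "real (card (rcf_class m ?lam))
      = real (card (axis_GL m (1::'a))) * (?q ^ m - 1) / rcf_denom ?q ?lam"
    using GL rcf_denom_nonzero[OF beta] by (simp add: eq_divide_eq)
  then have product: "real ?N * (?q ^ m - 1)
      = real (card (axis_GL m (1::'a))) * (?q ^ ?c - 1) / rcf_denom ?q ?lam * (?q ^ m - 1)"
    unfolding eigen[symmetric] by simp
  have "1 < ?q" using two_le_card_field[where 'a='a] by simp
  then have "?q ^ m - 1 \<noteq> 0" using one_less_power[OF _ m, of ?q] by simp
  then show ?thesis using product by (rule mult_right_cancel[THEN iffD1])
qed

lemma card_P_grp_filter:
  "card {x \<in> (P_grp n :: 'a::{finite,field} mat set). Q x} =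
    (\<Sum>a\<in>{a. a \<noteq> 0}. card {x \<in> axis_GL (n + 1) a. Q x})"
proof -
  have "{x \<in> (P_grp n :: 'a mat set). Q x} = (\<Union>a\<in>{a. a \<noteq> 0}. {x \<in> axis_GL (n + 1) a. Q x})"
    unfolding P_grp_eq by blast
  also have "card \<dots> = (\<Sum>a\<in>{a. a \<noteq> 0}. card {x \<in> axis_GL (n + 1) a. Q x})"
  proof (intro card_UN_disjoint ballI impI)
    show "finite {x \<in> axis_GL (n + 1) a. Q x}" for a :: 'a
      using finite_axis_GL by (rule rev_finite_subset) blast
    show "{x \<in> axis_GL (n + 1) a. Q x} \<inter> {x \<in> axis_GL (n + 1) b. Q x} = {}" if "a \<noteq> b" for a b :: 'a
      using axis_GL_disjoint[OF that, of n] by blast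
  qed simp
  finally show ?thesis .
qed

lemma card_P_grp:
  "card (P_grp n :: 'a::{finite,field} mat set) = (CARD('a) - 1) * card (A_grp n :: 'a mat set)"
proof -
  have "card (P_grp n :: 'a mat set) = (\<Sum>a\<in>{a::'a. a \<noteq> 0}. card (axis_GL (n + 1) a))"
    using card_P_grp_filter[of n "\<lambda>_. True"] by simp
  also have "\<dots> = (\<Sum>a\<in>{a::'a. a \<noteq> 0}. card (A_grp n :: 'a mat set))"
    unfolding A_grp_eq by (intro sum.cong card_axis_GL) auto
  also have "{a::'a. a \<noteq> 0} = UNIV - {0}" by auto
  finally show ?thesis by (simp add: card_Diff_singleton)
qed

theorem theorem2p3:
  fixes n :: nat and beta :: "'a::{finite,field} mat"
  assumes "beta \<in> GL (n+1)"
  defines "q \<equiv> real (card (UNIV :: 'a set))"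
  defines "lam \<equiv> rcf_data (n+1) beta"
  shows
    "(real (card {alpha \<in> (A_grp n :: 'a mat set). rcf_data (n+1) alpha = lam}) =
       real (card (A_grp n :: 'a mat set)) * (q ^ part_conj (lam [:-1,1:]) 1 - 1) / rcf_denom q lam) \<and>
     (real (card {alpha \<in> (P_grp n :: 'a mat set). rcf_data (n+1) alpha = lam}) =
       (\<Sum>a\<in>{a::'a. a \<noteq> 0}. real (card (P_grp n :: 'a mat set)) * (q ^ part_conj (lam [:-a,1:]) 1 - 1)
          / (q - 1) * (1 / rcf_denom q lam)))"
proof
  have axis_class: "real (card {x \<in> axis_GL (n + 1) a. rcf_data (n + 1) x = lam}) =
      real (card (A_grp n :: 'a mat set)) * (q ^ part_conj (lam [:-a,1:]) 1 - 1)
        / rcf_denom q lam" for a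
    unfolding lam_def q_def A_grp_eq by (rule card_axis_GL_rcf_data[OF assms(1)]) simp
  show "real (card {alpha \<in> (A_grp n :: 'a mat set). rcf_data (n+1) alpha = lam}) =
      real (card (A_grp n :: 'a mat set)) * (q ^ part_conj (lam [:-1,1:]) 1 - 1) / rcf_denom q lam"
    using axis_class[of 1] by (simp only: A_grp_eq)
  have "1 < q" using two_le_card_field[where 'a='a] by (simp add: q_def)
  then have P: "real (card (A_grp n :: 'a mat set)) = real (card (P_grp n :: 'a mat set)) / (q - 1)"
    by (simp add: card_P_grp q_def of_nat_diff)
  have "real (card {alpha \<in> (P_grp n :: 'a mat set). rcf_data (n+1) alpha = lam}) =
      (\<Sum>a\<in>{a::'a. a \<noteq> 0}. real (card {x \<in> axis_GL (n + 1) a. rcf_data (n + 1) x = lam}))"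
    by (simp only: card_P_grp_filter of_nat_sum)
  then show "real (card {alpha \<in> (P_grp n :: 'a mat set). rcf_data (n+1) alpha = lam}) =
      (\<Sum>a\<in>{a::'a. a \<noteq> 0}. real (card (P_grp n :: 'a mat set)) * (q ^ part_conj (lam [:-a,1:]) 1 - 1)
          / (q - 1) * (1 / rcf_denom q lam))"
    unfolding axis_class P by simp
qed

end
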